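(* Fix an equation $(f,q,w)$ as in the context. Let $\gamma\in(-\pi,\pi]$ and $K=(k_{ij})\in SL(2,\mathbb R)$ with $k_{11}-f_0k_{12}\neq0$. If $k_{11}\neq0$ let $\widehat K=\begin{pmatrix}k_{11}&k_{11}/f_0\\k_{21}&(f_0+k_{11}k_{21})/(k_{11}f_0)\end{pmatrix}$; if $k_{12}\neq0$ let $\widetilde K=\begin{pmatrix}f_0k_{12}&k_{12}\\(f_0k_{12}k_{22}-1)/k_{12}&k_{22}\end{pmatrix}$. Write $\lambda_n(e^{i\gamma}L)$ for the eigenvalues with boundary condition $[e^{i\gamma}L|-I]$. Then the problem with $[e^{i\gamma}K|-I]$ has exactly $N$ eigenvalues and the problems with $[e^{i\gamma}\widehat K|-I]$ and $[e^{i\gamma}\widetilde K|-I]$ (when defined) have exactly $N-1$ eigenvalues. Moreover: (i) if $k_{11}\ne0$, then $\lambda_n(e^{i\gamma}K)\le\lambda_n(e^{i\gamma}\widehat K)\le\lambda_{n+1}(e^{i\gamma}K)$ for $0\le n\le N-2$; (ii) if $k_{12}\neq0$, then $\lambda_n(e^{i\gamma}K)\le\lambda_n(e^{i\gamma}\widetilde K)\le\lambda_{n+1}(e^{i\gamma}K)$ for $0\le n\le N-2$.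
   Context: Let $N\ge2$ be an integer. An equation is given by real sequences $f=\{f_n\}_{n=0}^N$, $q=\{q_n\}_{n=1}^N$, $w=\{w_n\}_{n=1}^N$ with $f_n\neq0$, $w_n>0$; it is $-\nabla(f_n\Delta y_n)+q_ny_n=\lambda w_ny_n$, $1\le n\le N$, for $y=\{y_n\}_{n=0}^{N+1}$, $\Delta y_n=y_{n+1}-y_n$, $\nabla y_n=y_n-y_{n-1}$. The boundary condition $[A\,|\,B]$ is $A(y_0,f_0\Delta y_0)^T+B(y_N,f_N\Delta y_N)^T=0$. $SL(2,\mathbb R)$: real $2\times2$ matrices of determinant 1; $I$ the identity. Eigenvalues ($\lambda$ with a nontrivial solution) are real; multiplicity = dimension of the solution space (equal to the multiplicity as a zero of the characteristic polynomial); counted with multiplicity they are ordered $\lambda_0\le\lambda_1\le\cdots$, and "exactly $k$ eigenvalues" counts multiplicity. *)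

theory Defs
  imports "HOL-Analysis.Analysis" "HOL-Library.Function_Algebras" "HOL-Library.Multiset"
begin

text \<open>Discrete Sturm-Liouville problem
  -nabla(f_n Delta y_n) + q_n y_n = lambda w_n y_n, 1 <= n <= N,
  with boundary condition [A | B]:  A (y_0, f_0 Delta y_0)^T + B (y_N, f_N Delta y_N)^T = 0.
  Sequences y = (y_0, ..., y_{N+1}) are complex valued; they are represented as
  functions nat => complex vanishing for indices > N+1.\<close>

definition sl_solution ::
  "(nat \<Rightarrow> real) \<Rightarrow> (nat \<Rightarrow> real) \<Rightarrow> (nat \<Rightarrow> real) \<Rightarrow> nat \<Rightarrow>
   complex^2^2 \<Rightarrow> complex^2^2 \<Rightarrow> complex \<Rightarrow> (nat \<Rightarrow> complex) \<Rightarrow> bool" where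
  "sl_solution f q w N A B lam y \<longleftrightarrow>
     (\<forall>n > N + 1. y n = 0) \<and>
     (\<forall>n\<in>{1..N}.
        - (of_real (f n) * (y (n+1) - y n) - of_real (f (n-1)) * (y n - y (n-1)))
        + of_real (q n) * y n = lam * of_real (w n) * y n) \<and>
     A *v vector [y 0, of_real (f 0) * (y 1 - y 0)]
       + B *v vector [y N, of_real (f N) * (y (N+1) - y N)] = 0"

definition sl_solution_space ::
  "(nat \<Rightarrow> real) \<Rightarrow> (nat \<Rightarrow> real) \<Rightarrow> (nat \<Rightarrow> real) \<Rightarrow> nat \<Rightarrow>
   complex^2^2 \<Rightarrow> complex^2^2 \<Rightarrow> complex \<Rightarrow> (nat \<Rightarrow> complex) set" where
  "sl_solution_space f q w N A B lam = {y. sl_solution f q w N A B lam y}"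

definition sl_eigenvalues ::
  "(nat \<Rightarrow> real) \<Rightarrow> (nat \<Rightarrow> real) \<Rightarrow> (nat \<Rightarrow> real) \<Rightarrow> nat \<Rightarrow>
   complex^2^2 \<Rightarrow> complex^2^2 \<Rightarrow> complex set" where
  "sl_eigenvalues f q w N A B =
     {lam. \<exists>y. sl_solution f q w N A B lam y \<and> y \<noteq> 0}"

definition sl_mult ::
  "(nat \<Rightarrow> real) \<Rightarrow> (nat \<Rightarrow> real) \<Rightarrow> (nat \<Rightarrow> real) \<Rightarrow> nat \<Rightarrow>
   complex^2^2 \<Rightarrow> complex^2^2 \<Rightarrow> complex \<Rightarrow> nat" where
  "sl_mult f q w N A B lam =
     vector_space.dim (\<lambda>(c::complex) (y::nat \<Rightarrow> complex). (\<lambda>n. c * y n))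
       (sl_solution_space f q w N A B lam)"

definition sl_eig_mset ::
  "(nat \<Rightarrow> real) \<Rightarrow> (nat \<Rightarrow> real) \<Rightarrow> (nat \<Rightarrow> real) \<Rightarrow> nat \<Rightarrow>
   complex^2^2 \<Rightarrow> complex^2^2 \<Rightarrow> complex multiset" where
  "sl_eig_mset f q w N A B =
     (\<Sum>lam\<in>sl_eigenvalues f q w N A B. replicate_mset (sl_mult f q w N A B lam) lam)"

definition sl_has_exactly ::
  "(nat \<Rightarrow> real) \<Rightarrow> (nat \<Rightarrow> real) \<Rightarrow> (nat \<Rightarrow> real) \<Rightarrow> nat \<Rightarrow>
   complex^2^2 \<Rightarrow> complex^2^2 \<Rightarrow> nat \<Rightarrow> bool" where
  "sl_has_exactly f q w N A B k \<longleftrightarrow>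
     finite (sl_eigenvalues f q w N A B) \<and> size (sl_eig_mset f q w N A B) = k"

text \<open>lambda_n: the n-th eigenvalue (0-based) in nondecreasing order, counted with
  multiplicity.  Eigenvalues are real, so we order their real parts.\<close>
definition sl_lambda ::
  "(nat \<Rightarrow> real) \<Rightarrow> (nat \<Rightarrow> real) \<Rightarrow> (nat \<Rightarrow> real) \<Rightarrow> nat \<Rightarrow>
   complex^2^2 \<Rightarrow> complex^2^2 \<Rightarrow> nat \<Rightarrow> real" where
  "sl_lambda f q w N A B n =
     sorted_list_of_multiset (image_mset Re (sl_eig_mset f q w N A B)) ! n"

definition cis_mat :: "real \<Rightarrow> real^2^2 \<Rightarrow> complex^2^2" where
  "cis_mat \<gamma> L = (\<chi> i j. cis \<gamma> * of_real (L $ i $ j))"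

definition mat22 :: "real \<Rightarrow> real \<Rightarrow> real \<Rightarrow> real \<Rightarrow> real^2^2" where
  "mat22 a b c d = vector [vector [a, b], vector [c, d]]"

definition K_hat :: "real \<Rightarrow> real^2^2 \<Rightarrow> real^2^2" where
  "K_hat f0 K = mat22 (K$1$1) (K$1$1 / f0)
                      (K$2$1) ((f0 + K$1$1 * K$2$1) / (K$1$1 * f0))"

definition K_tilde :: "real \<Rightarrow> real^2^2 \<Rightarrow> real^2^2" where
  "K_tilde f0 K = mat22 (f0 * K$1$2) (K$1$2)
                        ((f0 * K$1$2 * K$2$2 - 1) / K$1$2) (K$2$2)"

end

theory Submission
  imports Defs
begin

text \<open>Since \<open>f 0 \<noteq> 0\<close>, a boundary condition \<open>L\<close> couples \<open>y 1\<close> and \<open>y N\<close> to the fluxes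
  \<open>f 0 * (y 1 - y 0)\<close> and \<open>f N * (y (N + 1) - y N)\<close>, and \<open>det L = 1\<close> makes this coupling a Lagrangian
  relation. Summation by parts therefore turns the problem for \<open>L\<close> into an eigenvalue problem for a
  Hermitian form on those sequences over \<open>{1..N}\<close> whose end values admit fluxes. If \<open>L11 \<noteq> f 0 * L12\<close>,
  these are all sequences; if \<open>L11 = f 0 * L12\<close>, they form the hyperplane \<open>y N = cis \<gamma> * L11 * y 1\<close>.
  The matrices \<open>K_hat\<close> and \<open>K_tilde\<close> are of the latter kind and share a column with \<open>K\<close>, whence
  \<open>det (K - L) = 0\<close>. This makes their form the restriction of the form of \<open>K\<close>, and the claim is
  Cauchy interlacing for a subspace of codimension one.\<close>

subsection \<open>Dimension and linear functionals\<close>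

definition (in vector_space) finite_dim :: "'b set \<Rightarrow> bool" where
  "finite_dim S \<longleftrightarrow> (\<exists>B. finite B \<and> S \<subseteq> span B)"

lemma (in vector_space) finite_dim_subset: "finite_dim S \<Longrightarrow> T \<subseteq> S \<Longrightarrow> finite_dim T"
  unfolding finite_dim_def by blast

lemma (in vector_space) finite_dim_basis:
  assumes "finite_dim S"
  obtains B where "finite B" "B \<subseteq> S" "independent B" "S \<subseteq> span B" "card B = dim S"
proof -
  obtain B where B: "B \<subseteq> S" "independent B" "S \<subseteq> span B" "card B = dim S"
    by (rule basis_exists)
  moreover have "finite B"
    using assms independent_span_bound[OF _ B(2)] B(1) unfolding finite_dim_def by blast
  ultimately show thesis using that by blast
qed

lemma (in vector_space) subspace_functional_kernel:
  assumes "Vector_Spaces.linear scale (*) \<phi>" "subspace S"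
  shows "subspace {x \<in> S. \<phi> x = 0}"
proof -
  interpret \<phi>: Vector_Spaces.linear scale "(*)" \<phi> by fact
  show ?thesis
    using assms(2) by (auto simp: subspace_def \<phi>.add \<phi>.scale)
qed

lemma (in vector_space) dim_functional_kernel:
  assumes "Vector_Spaces.linear scale (*) \<phi>" "subspace S" "finite_dim S" "v \<in> S" "\<phi> v \<noteq> 0"
  shows "dim S = Suc (dim {x \<in> S. \<phi> x = 0})" (is "_ = Suc (dim ?K)")
proof -
  interpret \<phi>: Vector_Spaces.linear scale "(*)" \<phi> by fact
  have "subspace ?K" using assms(1,2) by (rule subspace_functional_kernel)
  have "finite_dim ?K" by (rule finite_dim_subset[OF assms(3)]) blast
  then obtain B where B: "finite B" "B \<subseteq> ?K" "independent B" "?K \<subseteq> span B" "card B = dim ?K"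
    by (rule finite_dim_basis)
  have "v \<notin> span B"
    using span_minimal[OF B(2) \<open>subspace ?K\<close>] assms(5) by auto
  show ?thesis
  proof (rule dim_unique)
    show "insert v B \<subseteq> S" using B(2) assms(4) by blast
    show "independent (insert v B)" using \<open>v \<notin> span B\<close> B(3) by (rule independent_insertI)
    show "S \<subseteq> span (insert v B)"
    proof
      fix x assume "x \<in> S"
      then have "x - scale (\<phi> x / \<phi> v) v \<in> ?K"
        using assms by (simp add: \<phi>.diff \<phi>.scale subspace_diff subspace_scale)
      then show "x \<in> span (insert v B)" using B(4) unfolding span_insert by blast
    qed
    show "card (insert v B) = Suc (dim ?K)"
      using \<open>v \<notin> span B\<close> span_base B(1,5) by (metis card_insert_disjoint)
  qed
qed

lemma (in vector_space) exists_common_zero: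
  assumes "finite \<Phi>" "\<And>\<phi>. \<phi> \<in> \<Phi> \<Longrightarrow> Vector_Spaces.linear scale (*) \<phi>"
    and "subspace S" "finite_dim S" "card \<Phi> < dim S"
  shows "\<exists>x\<in>S. x \<noteq> 0 \<and> (\<forall>\<phi>\<in>\<Phi>. \<phi> x = 0)"
  using assms
proof (induction \<Phi> arbitrary: S rule: finite_induct)
  case empty
  then have "\<not> S \<subseteq> span {}" using dim_le_card[of S "{}"] by auto
  then show ?case by auto
next
  case (insert \<phi> \<Phi>)
  let ?K = "{x \<in> S. \<phi> x = 0}"
  have "dim S \<le> Suc (dim ?K)"
  proof (cases "\<exists>v\<in>S. \<phi> v \<noteq> 0")
    case True
    then show ?thesis using dim_functional_kernel insert.prems by fastforce
  next
    case False
    then have "?K = S" by blast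
    then show ?thesis by simp
  qed
  then have "card \<Phi> < dim ?K" using insert.hyps insert.prems by simp
  moreover have "subspace ?K" "finite_dim ?K"
    using insert.prems subspace_functional_kernel by (blast, blast intro: finite_dim_subset)
  ultimately have "\<exists>x\<in>?K. x \<noteq> 0 \<and> (\<forall>\<phi>\<in>\<Phi>. \<phi> x = 0)"
    using insert.prems(1) by (intro insert.IH) auto
  then show ?case by blast
qed

lemma dim_image_inj_on:
  assumes "Vector_Spaces.linear s1 s2 f" "module.subspace s1 S" "inj_on f S"
  shows "vector_space.dim s2 (f ` S) = vector_space.dim s1 S"
proof -
  interpret Vector_Spaces.linear s1 s2 f by fact
  obtain B where B: "B \<subseteq> S" "vs1.independent B" "S \<subseteq> vs1.span B" "card B = vs1.dim S"
    using vs1.basis_exists by blast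
  have span: "vs1.span B = S"
    using B assms(2) by (simp add: subset_antisym vs1.span_minimal)
  have "vs2.dim (f ` S) = card (f ` B)"
    using span span_image independent_injective_image[OF B(2)] assms(3)
    by (metis vs2.dim_span_eq_card_independent)
  also have "\<dots> = card B"
    using B(1) assms(3) inj_on_subset by (intro card_image) blast
  finally show ?thesis using B(4) by simp
qed

subsection \<open>The unit sphere in coordinates\<close>

definition coordinate_sphere :: "'a set \<Rightarrow> ('a \<Rightarrow> complex) set" where
  "coordinate_sphere B = {c. (\<forall>v. v \<notin> B \<longrightarrow> c v = 0) \<and> (\<Sum>v\<in>B. (cmod (c v))\<^sup>2) = 1}"

lemma compact_coordinate_sphere:
  fixes B :: "'a set"
  assumes "finite B"
  shows "compact (coordinate_sphere B)"
proof -
  define P :: "('a \<Rightarrow> complex) set" where "P = PiE UNIV (\<lambda>v. if v \<in> B then cball 0 1 else {0})"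
  have "compactin (product_topology (\<lambda>_. euclidean) UNIV) P"
    unfolding P_def compactin_PiE by auto
  then have "compact P"
    by (simp add: euclidean_product_topology compactin_euclidean_iff)
  moreover have "closed {c :: 'a \<Rightarrow> complex. (\<Sum>v\<in>B. (cmod (c v))\<^sup>2) = 1}"
    by (intro closed_Collect_eq continuous_intros continuous_on_product_coordinates)
  moreover have "coordinate_sphere B = P \<inter> {c. (\<Sum>v\<in>B. (cmod (c v))\<^sup>2) = 1}"
  proof -
    have "cmod (c v) \<le> 1" if "(\<Sum>v\<in>B. (cmod (c v))\<^sup>2) = 1" "v \<in> B" for c :: "'a \<Rightarrow> complex" and v
      using member_le_sum[of v B "\<lambda>v. (cmod (c v))\<^sup>2"] assms that by (simp add: power_le_one_iff)
    then show ?thesis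
      unfolding coordinate_sphere_def P_def by (auto simp: PiE_def Pi_def split: if_splits)
  qed
  ultimately show ?thesis by (simp add: compact_Int_closed)
qed

lemma coordinate_sphere_normalize:
  assumes "finite B" "\<exists>v\<in>B. d v \<noteq> 0"
  shows "\<exists>c\<in>coordinate_sphere B. \<exists>a. a \<noteq> 0 \<and> (\<forall>v\<in>B. c v = a * d v)"
proof -
  define r where "r = sqrt (\<Sum>v\<in>B. (cmod (d v))\<^sup>2)"
  obtain v where "v \<in> B" "d v \<noteq> 0" using assms(2) by blast
  then have "0 < (\<Sum>v\<in>B. (cmod (d v))\<^sup>2)"
    by (intro sum_pos2[OF assms(1)]) auto
  then have r: "r > 0" "(\<Sum>v\<in>B. (cmod (d v))\<^sup>2) = r\<^sup>2"
    by (simp_all add: r_def)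
  define c where "c v = (if v \<in> B then of_real (1 / r) * d v else 0)" for v
  have "(\<Sum>v\<in>B. (cmod (c v))\<^sup>2) = (\<Sum>v\<in>B. (cmod (d v))\<^sup>2) / r\<^sup>2"
    unfolding sum_divide_distrib using r(1)
    by (intro sum.cong) (auto simp: c_def norm_divide power_divide)
  then have "c \<in> coordinate_sphere B"
    using r by (simp add: coordinate_sphere_def c_def)
  then show ?thesis
    using r(1) by (intro bexI[of _ c] exI[of _ "of_real (1 / r)"]) (auto simp: c_def)
qed

locale complex_vector_space = vector_space scale
  for scale :: "complex \<Rightarrow> 'a::ab_group_add \<Rightarrow> 'a" (infixr \<open>\<cdot>\<close> 75)

lemma (in complex_vector_space) coordinate_sphere_combination_nonzero:
  assumes "finite B" "independent B" "c \<in> coordinate_sphere B"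
  shows "(\<Sum>v\<in>B. c v \<cdot> v) \<noteq> 0"
proof
  assume "(\<Sum>v\<in>B. c v \<cdot> v) = 0"
  then have "\<forall>v\<in>B. c v = 0"
    using independentD[OF assms(2,1) order_refl] by blast
  then show False using assms(3) by (simp add: coordinate_sphere_def)
qed

lemma (in complex_vector_space) coordinate_sphere_combination_multiple:
  assumes B: "finite B" and x: "x \<in> span B" "x \<noteq> 0"
  shows "\<exists>c\<in>coordinate_sphere B. \<exists>a. a \<noteq> 0 \<and> (\<Sum>v\<in>B. c v \<cdot> v) = a \<cdot> x"
proof -
  obtain d where d: "x = (\<Sum>v\<in>B. d v \<cdot> v)"
    using x(1) unfolding span_finite[OF B] by blast
  have "\<exists>v\<in>B. d v \<noteq> 0"
  proof (rule ccontr)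
    assume "\<not> (\<exists>v\<in>B. d v \<noteq> 0)"
    then show False using x(2) by (simp add: d)
  qed
  then obtain c a where c: "c \<in> coordinate_sphere B" "a \<noteq> 0" "\<forall>v\<in>B. c v = a * d v"
    using coordinate_sphere_normalize[OF B] by blast
  then have "(\<Sum>v\<in>B. c v \<cdot> v) = a \<cdot> x"
    unfolding d scale_sum_right by (intro sum.cong) auto
  then show ?thesis using c by blast
qed

subsection \<open>Hermitian forms and Rayleigh quotients\<close>

locale hermitian_form = complex_vector_space scale
  for scale :: "complex \<Rightarrow> 'a::ab_group_add \<Rightarrow> 'a" (infixr \<open>\<cdot>\<close> 75) +
  fixes b :: "'a \<Rightarrow> 'a \<Rightarrow> complex"
  assumes add_right: "b x (y + z) = b x y + b x z"
    and scale_right: "b x (c \<cdot> y) = c * b x y"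
    and hermitian: "b x y = cnj (b y x)"
begin

lemma linear_right: "Vector_Spaces.linear scale (*) (b x)"
  by unfold_locales (simp_all add: add_right scale_right algebra_simps)

sublocale right: Vector_Spaces.linear scale "(*)" "b x" for x
  by (rule linear_right)

lemma add_left: "b (x + y) z = b x z + b y z"
  by (metis add_right complex_cnj_add hermitian)

lemma scale_left: "b (c \<cdot> x) y = cnj c * b x y"
  by (metis scale_right complex_cnj_mult hermitian)

lemma diag_real: "b x x = of_real (Re (b x x))"
  using hermitian[of x x] by (simp add: complex_eq_iff)

lemma eq_0_commute: "b x y = 0 \<longleftrightarrow> b y x = 0"
  by (subst hermitian) simp

lemma zero_left: "b 0 x = 0"
  using eq_0_commute right.zero by blast

lemma diag_sum:
  "b (\<Sum>i\<in>A. c i \<cdot> v i) (\<Sum>i\<in>A. c i \<cdot> v i) = (\<Sum>i\<in>A. \<Sum>j\<in>A. cnj (c i) * c j * b (v i) (v j))"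
proof -
  have sum_left: "b (\<Sum>i\<in>A. c i \<cdot> v i) y = (\<Sum>i\<in>A. cnj (c i) * b (v i) y)" for y
    by (induction A rule: infinite_finite_induct) (simp_all add: zero_left add_left scale_left)
  show ?thesis
    unfolding sum_left unfolding right.sum scale_right sum_distrib_left by (simp add: mult_ac)
qed

lemma diag_scale: "b (c \<cdot> x) (c \<cdot> x) = of_real ((cmod c)\<^sup>2) * b x x"
  by (simp add: scale_left scale_right complex_norm_square mult_ac del: of_real_power)

lemma diag_perturb:
  "Re (b (x + c \<cdot> u) (x + c \<cdot> u)) = Re (b x x) + 2 * Re (c * b x u) + (cmod c)\<^sup>2 * Re (b u u)"
proof -
  have "b (x + c \<cdot> u) (x + c \<cdot> u) = b x x + c * b x u + cnj (c * b x u) + b (c \<cdot> u) (c \<cdot> u)"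
    using hermitian[of u x] by (simp add: add_left add_right scale_left scale_right algebra_simps)
  then show ?thesis by (simp add: diag_scale del: of_real_power)
qed

lemma semidefinite_null_vector:
  assumes "subspace E" and nonneg: "\<And>x. x \<in> E \<Longrightarrow> 0 \<le> Re (b x x)"
    and "u \<in> E" "Re (b u u) = 0" "x \<in> E"
  shows "b x u = 0"
proof (rule ccontr)
  assume "b x u \<noteq> 0"
  define t where "t = (Re (b x x) + 1) / (2 * (cmod (b x u))\<^sup>2)"
  define c where "c = - of_real t * cnj (b x u)"
  have "Re (c * b x u) = - t * (cmod (b x u))\<^sup>2"
    unfolding c_def cmod_power2 by (simp add: power2_eq_square algebra_simps)
  moreover have "2 * (t * (cmod (b x u))\<^sup>2) = Re (b x x) + 1"
    using \<open>b x u \<noteq> 0\<close> by (simp add: t_def)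
  ultimately have "Re (b (x + c \<cdot> u) (x + c \<cdot> u)) = - 1"
    unfolding diag_perturb assms(4) by simp
  moreover have "x + c \<cdot> u \<in> E"
    using assms by (intro subspace_add subspace_scale) auto
  ultimately show False using nonneg by fastforce
qed

lemma continuous_on_diag_combination:
  "continuous_on S (\<lambda>c. Re (b (\<Sum>v\<in>B. c v \<cdot> v) (\<Sum>v\<in>B. c v \<cdot> v)))"
proof -
  have "continuous_on S (\<lambda>c::'a \<Rightarrow> complex. c v)" for v
    by (rule continuous_on_subset[OF continuous_on_product_coordinates]) simp
  then show ?thesis
    unfolding diag_sum by (intro continuous_intros)
qed

end

locale hermitian_pencil =
  complex_vector_space scale + g: hermitian_form scale g + h: hermitian_form scale h
  for scale :: "complex \<Rightarrow> 'a::ab_group_add \<Rightarrow> 'a" (infixr \<open>\<cdot>\<close> 75)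
    and g h :: "'a \<Rightarrow> 'a \<Rightarrow> complex" +
  fixes V :: "'a set"
  assumes finite_dim_V: "finite_dim V"
    and g_pos: "x \<in> V \<Longrightarrow> x \<noteq> 0 \<Longrightarrow> Re (g x x) > 0"
begin

lemma finite_dim_subset_V: "E \<subseteq> V \<Longrightarrow> finite_dim E"
  using finite_dim_V by (rule finite_dim_subset)

definition rayleigh :: "'a \<Rightarrow> real" where
  "rayleigh x = Re (h x x) / Re (g x x)"

lemma rayleigh_scale: "c \<noteq> 0 \<Longrightarrow> rayleigh (c \<cdot> x) = rayleigh x"
  by (simp add: rayleigh_def g.diag_scale h.diag_scale del: of_real_power)

lemma rayleigh_attains_min:
  assumes E: "subspace E" "E \<subseteq> V" "E \<noteq> {0}"
  shows "\<exists>u\<in>E. u \<noteq> 0 \<and> (\<forall>x\<in>E. x \<noteq> 0 \<longrightarrow> rayleigh u \<le> rayleigh x)"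
proof -
  obtain B where B: "finite B" "B \<subseteq> E" "independent B" "E \<subseteq> span B"
    using finite_dim_subset_V[OF E(2)] by (rule finite_dim_basis)
  let ?S = "coordinate_sphere B"
  define comb where "comb c = (\<Sum>v\<in>B. c v \<cdot> v)" for c
  have comb_E: "comb c \<in> E" for c
    unfolding comb_def using B(2) E(1) by (intro subspace_sum subspace_scale) auto
  have comb_nonzero: "comb c \<noteq> 0" if "c \<in> ?S" for c
    unfolding comb_def using B(1,3) that by (rule coordinate_sphere_combination_nonzero)
  have multiple: "\<exists>c\<in>?S. \<exists>a. a \<noteq> 0 \<and> comb c = a \<cdot> x" if "x \<in> E" "x \<noteq> 0" for x
    unfolding comb_def using that B(1,4) by (intro coordinate_sphere_combination_multiple) auto
  have "compact ?S" using B(1) by (rule compact_coordinate_sphere)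
  moreover have "?S \<noteq> {}"
    using multiple E(3) subspace_0[OF E(1)] by blast
  moreover have "continuous_on ?S (\<lambda>c. rayleigh (comb c))"
    unfolding rayleigh_def comb_def
  proof (intro continuous_on_divide ballI
      g.continuous_on_diag_combination h.continuous_on_diag_combination)
    fix c assume "c \<in> ?S"
    then have "0 < Re (g (comb c) (comb c))"
      using comb_E comb_nonzero E(2) by (intro g_pos) auto
    then show "Re (g (\<Sum>v\<in>B. c v \<cdot> v) (\<Sum>v\<in>B. c v \<cdot> v)) \<noteq> 0" by (simp add: comb_def)
  qed
  ultimately obtain c where c: "c \<in> ?S" "\<And>d. d \<in> ?S \<Longrightarrow> rayleigh (comb c) \<le> rayleigh (comb d)"
    using continuous_attains_inf[of ?S "\<lambda>c. rayleigh (comb c)"] by blast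
  have "rayleigh (comb c) \<le> rayleigh x" if x: "x \<in> E" "x \<noteq> 0" for x
  proof -
    obtain d a where "d \<in> ?S" "a \<noteq> 0" "comb d = a \<cdot> x" using multiple[OF x] by blast
    then show ?thesis using c(2)[of d] rayleigh_scale[of a x] by simp
  qed
  then show ?thesis using comb_E comb_nonzero[OF c(1)] by blast
qed

definition eigenspace :: "'a set \<Rightarrow> complex \<Rightarrow> 'a set" where
  "eigenspace E a = {y \<in> E. \<forall>x\<in>E. h x y = a * g x y}"

lemma subspace_eigenspace:
  assumes "subspace E"
  shows "subspace (eigenspace E a)"
proof (rule subspaceI)
  show "0 \<in> eigenspace E a"
    using subspace_0[OF assms] by (simp add: eigenspace_def g.right.zero h.right.zero)
  show "x + y \<in> eigenspace E a" if "x \<in> eigenspace E a" "y \<in> eigenspace E a" for x y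
    using that subspace_add[OF assms] by (simp add: eigenspace_def g.add_right h.add_right distrib_left)
  show "c \<cdot> x \<in> eigenspace E a" if "x \<in> eigenspace E a" for c x
    using that subspace_scale[OF assms] by (simp add: eigenspace_def g.scale_right h.scale_right)
qed

lemma rayleigh_eigenvector:
  assumes "y \<in> eigenspace E (of_real r)" "E \<subseteq> V" "y \<noteq> 0"
  shows "rayleigh y = r"
proof -
  have "h y y = of_real r * g y y" using assms(1) by (simp add: eigenspace_def)
  moreover have "Re (g y y) > 0" using assms by (intro g_pos) (auto simp: eigenspace_def)
  ultimately show ?thesis by (simp add: rayleigh_def)
qed

lemma rayleigh_min_eigenvector:
  assumes E: "subspace E" "E \<subseteq> V"
    and u: "u \<in> E" "u \<noteq> 0" "\<And>x. x \<in> E \<Longrightarrow> x \<noteq> 0 \<Longrightarrow> rayleigh u \<le> rayleigh x"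
  shows "u \<in> eigenspace E (of_real (rayleigh u))"
proof -
  let ?b = "\<lambda>x y. h x y - of_real (rayleigh u) * g x y"
  interpret b: hermitian_form scale ?b
  proof unfold_locales
    show "?b x y = cnj (?b y x)" for x y
      using g.hermitian[of x y] h.hermitian[of x y] by simp
    show "?b x (y + z) = ?b x y + ?b x z" for x y z
      unfolding g.add_right h.add_right by (simp add: distrib_left)
    show "?b x (c \<cdot> y) = c * ?b x y" for c x y
      unfolding g.scale_right h.scale_right by (simp add: right_diff_distrib)
  qed
  have "0 \<le> Re (?b x x)" if "x \<in> E" for x
  proof (cases "x = 0")
    case False
    then have "Re (g x x) > 0" using that E(2) by (intro g_pos) auto
    moreover have "rayleigh u \<le> Re (h x x) / Re (g x x)"
      using u(3)[OF that False] by (simp only: rayleigh_def[of x])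
    ultimately show ?thesis by (simp add: pos_le_divide_eq)
  qed (simp add: g.zero_left h.zero_left)
  moreover have "Re (?b u u) = 0"
    using g_pos[of u] u(1,2) E(2) by (auto simp: rayleigh_def)
  ultimately have "?b x u = 0" if "x \<in> E" for x
    using E(1) u(1) that by (intro b.semidefinite_null_vector)
  then show ?thesis using u(1) by (simp add: eigenspace_def)
qed

lemma normalized_min_eigenvector:
  assumes E: "subspace E" "E \<subseteq> V" "E \<noteq> {0}"
  obtains u where "u \<in> eigenspace E (of_real (rayleigh u))" "g u u = 1"
    "\<And>x. x \<in> E \<Longrightarrow> x \<noteq> 0 \<Longrightarrow> rayleigh u \<le> rayleigh x"
proof -
  obtain v where v: "v \<in> E" "v \<noteq> 0" "\<And>x. x \<in> E \<Longrightarrow> x \<noteq> 0 \<Longrightarrow> rayleigh v \<le> rayleigh x"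
    using rayleigh_attains_min[OF E] by blast
  define r where "r = Re (g v v)"
  have "r > 0" using g_pos[of v] v(1,2) E(2) by (auto simp: r_def)
  have g_vv: "g v v = of_real r" unfolding r_def by (rule g.diag_real)
  define u where "u = of_real (1 / sqrt r) \<cdot> v"
  have "(cmod (of_real (1 / sqrt r)))\<^sup>2 * r = 1"
    using \<open>r > 0\<close> by (simp add: norm_divide power_divide)
  then have "g u u = 1"
    unfolding u_def g.diag_scale g_vv by (metis of_real_mult of_real_1)
  have u: "u \<in> E" "u \<noteq> 0" "rayleigh u = rayleigh v"
    using v(1,2) E(1) \<open>r > 0\<close> by (simp_all add: u_def subspace_scale rayleigh_scale)
  have u_min: "rayleigh u \<le> rayleigh x" if "x \<in> E" "x \<noteq> 0" for x
    using v(3)[OF that] u(3) by simp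
  have "u \<in> eigenspace E (of_real (rayleigh u))"
    using E(1,2) u(1,2) u_min by (rule rayleigh_min_eigenvector)
  then show thesis using \<open>g u u = 1\<close> u_min by (rule that)
qed

lemma orthogonal_remainder:
  assumes "subspace E" "u \<in> E" "g u u = 1" "x \<in> E"
  shows "x - g u x \<cdot> u \<in> {x \<in> E. g u x = 0}"
  using assms by (simp add: subspace_diff subspace_scale g.right.diff g.scale_right)

lemma eigenspace_orthogonal_complement:
  assumes E: "subspace E" and u: "u \<in> eigenspace E (of_real r)" "g u u = 1"
    and y: "y \<in> eigenspace {x \<in> E. g u x = 0} a"
  shows "y \<in> eigenspace E a"
proof -
  have uE: "u \<in> E" using u(1) by (simp add: eigenspace_def)
  have yE: "y \<in> E" "g u y = 0" using y by (auto simp: eigenspace_def)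
  have "h y u = 0" using u(1) yE g.eq_0_commute[of y u] by (simp add: eigenspace_def)
  then have huy: "h u y = 0" using h.eq_0_commute by blast
  have "h x y = a * g x y" if x: "x \<in> E" for x
  proof -
    define x' where "x' = x - g u x \<cdot> u"
    have "h x' y = a * g x' y"
      using y orthogonal_remainder[OF E uE u(2) x] by (simp add: x'_def eigenspace_def)
    moreover have "x = x' + g u x \<cdot> u" by (simp add: x'_def)
    then have "h x y = h x' y" "g x y = g x' y"
      using huy yE(2) by (metis h.add_left h.scale_left mult_zero_right add_0_right,
          metis g.add_left g.scale_left mult_zero_right add_0_right)
    ultimately show ?thesis by simp
  qed
  then show ?thesis using yE by (simp add: eigenspace_def)
qed

subsection \<open>Eigenbases\<close>

definition eigenbasis :: "'a set \<Rightarrow> (nat \<Rightarrow> 'a) \<Rightarrow> (nat \<Rightarrow> real) \<Rightarrow> bool" where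
  "eigenbasis E e \<mu> \<longleftrightarrow>
     (\<forall>i<dim E. e i \<in> eigenspace E (of_real (\<mu> i))) \<and>
     (\<forall>i<dim E. \<forall>j<dim E. g (e i) (e j) = of_bool (i = j)) \<and>
     (\<forall>i j. i \<le> j \<longrightarrow> j < dim E \<longrightarrow> \<mu> i \<le> \<mu> j) \<and>
     (\<forall>y\<in>E. y = (\<Sum>i<dim E. g (e i) y \<cdot> e i))"

context
  fixes E e \<mu> assumes basis: "eigenbasis E e \<mu>"
begin

lemma eigenbasis_eigenspace: "i < dim E \<Longrightarrow> e i \<in> eigenspace E (of_real (\<mu> i))"
  using basis unfolding eigenbasis_def by blast

lemma eigenbasis_mem: "i < dim E \<Longrightarrow> e i \<in> E"
  using eigenbasis_eigenspace by (auto simp: eigenspace_def)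

lemma eigenbasis_orthonormal: "i < dim E \<Longrightarrow> j < dim E \<Longrightarrow> g (e i) (e j) = of_bool (i = j)"
  using basis unfolding eigenbasis_def by blast

lemma eigenbasis_mono: "i \<le> j \<Longrightarrow> j < dim E \<Longrightarrow> \<mu> i \<le> \<mu> j"
  using basis unfolding eigenbasis_def by blast

lemma eigenbasis_expansion: "y \<in> E \<Longrightarrow> y = (\<Sum>i<dim E. g (e i) y \<cdot> e i)"
  using basis unfolding eigenbasis_def by blast

lemma eigenbasis_nonzero: "i < dim E \<Longrightarrow> e i \<noteq> 0"
  using eigenbasis_orthonormal[of i i] g.zero_left[of "e i"] by auto

lemma eigenbasis_rayleigh: "i < dim E \<Longrightarrow> E \<subseteq> V \<Longrightarrow> rayleigh (e i) = \<mu> i"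
  using eigenbasis_eigenspace eigenbasis_nonzero by (blast intro: rayleigh_eigenvector)

lemma eigenbasis_h_right: "i < dim E \<Longrightarrow> y \<in> E \<Longrightarrow> h y (e i) = of_real (\<mu> i) * g y (e i)"
  using eigenbasis_eigenspace by (auto simp: eigenspace_def)

lemma eigenbasis_h_left: "i < dim E \<Longrightarrow> y \<in> E \<Longrightarrow> h (e i) y = of_real (\<mu> i) * g (e i) y"
  by (subst h.hermitian, subst g.hermitian) (simp add: eigenbasis_h_right)

lemma eigenbasis_inj: "inj_on e {..<dim E}"
proof (rule inj_onI)
  fix i j assume "i \<in> {..<dim E}" "j \<in> {..<dim E}" "e i = e j"
  then show "i = j"
    using eigenbasis_orthonormal[of i i] eigenbasis_orthonormal[of i j] by (auto split: if_splits)
qed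

lemma eigenspace_eq_span:
  assumes "subspace E"
  shows "eigenspace E a = span (e ` {i. i < dim E \<and> of_real (\<mu> i) = a})" (is "_ = span (e ` ?J)")
proof
  show "eigenspace E a \<subseteq> span (e ` ?J)"
  proof
    fix y assume y: "y \<in> eigenspace E a"
    then have yE: "y \<in> E" by (simp add: eigenspace_def)
    have coeff_0: "g (e i) y = 0" if "i < dim E" "of_real (\<mu> i) \<noteq> a" for i
      using eigenbasis_h_left[OF that(1) yE] y eigenbasis_mem[OF that(1)] that(2)
      by (simp add: eigenspace_def)
    have "y = (\<Sum>i<dim E. g (e i) y \<cdot> e i)" using yE by (rule eigenbasis_expansion)
    also have "\<dots> = (\<Sum>i\<in>?J. g (e i) y \<cdot> e i)"
      using coeff_0 by (intro sum.mono_neutral_right) auto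
    also have "\<dots> \<in> span (e ` ?J)"
      by (intro span_sum span_scale span_base) auto
    finally show "y \<in> span (e ` ?J)" .
  qed
  have "e ` ?J \<subseteq> eigenspace E a"
    using eigenbasis_eigenspace by auto
  then show "span (e ` ?J) \<subseteq> eigenspace E a"
    using subspace_eigenspace[OF assms] by (rule span_minimal)
qed

lemma eigenbasis_independent: "independent (e ` {..<dim E})"
proof (rule independent_if_scalars_zero)
  fix c v assume c: "(\<Sum>x\<in>e ` {..<dim E}. c x \<cdot> x) = 0" and "v \<in> e ` {..<dim E}"
  then obtain i where i: "i < dim E" "v = e i" by blast
  have "0 = g (e i) (\<Sum>j<dim E. c (e j) \<cdot> e j)"
    using c by (simp add: sum.reindex[OF eigenbasis_inj] g.right.zero)
  also have "\<dots> = (\<Sum>j<dim E. if i = j then c (e j) else 0)"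
    unfolding g.right.sum g.scale_right using i(1)
    by (intro sum.cong) (auto simp: eigenbasis_orthonormal)
  finally show "c v = 0" using i by simp
qed simp

lemma dim_eigenspace:
  assumes "subspace E"
  shows "dim (eigenspace E a) = card {i. i < dim E \<and> of_real (\<mu> i) = a}"
proof -
  have J: "{i. i < dim E \<and> of_real (\<mu> i) = a} \<subseteq> {..<dim E}" by auto
  show ?thesis
    unfolding eigenspace_eq_span[OF assms]
    using dim_span_eq_card_independent[OF independent_mono[OF eigenbasis_independent image_mono[OF J]]]
      card_image[OF inj_on_subset[OF eigenbasis_inj J]] by simp
qed

lemma eigenvalue_iff:
  assumes "subspace E"
  shows "(\<exists>y\<in>eigenspace E a. y \<noteq> 0) \<longleftrightarrow> a \<in> (of_real \<circ> \<mu>) ` {..<dim E}"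
proof
  assume "\<exists>y\<in>eigenspace E a. y \<noteq> 0"
  then have "{i. i < dim E \<and> of_real (\<mu> i) = a} \<noteq> {}"
    unfolding eigenspace_eq_span[OF assms] by force
  then show "a \<in> (of_real \<circ> \<mu>) ` {..<dim E}" by auto
next
  assume "a \<in> (of_real \<circ> \<mu>) ` {..<dim E}"
  then obtain i where i: "i < dim E" "a = of_real (\<mu> i)" by auto
  then have "e i \<in> eigenspace E a" using eigenbasis_eigenspace by simp
  moreover have "e i \<noteq> 0" using i(1) by (rule eigenbasis_nonzero)
  ultimately show "\<exists>y\<in>eigenspace E a. y \<noteq> 0" by blast
qed

lemma form_eigenbasis_expansion:
  assumes y: "y \<in> E"
  shows "Re (h y y) - t * Re (g y y) = (\<Sum>i<dim E. (\<mu> i - t) * (cmod (g (e i) y))\<^sup>2)"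
proof -
  have "g y y = (\<Sum>i<dim E. g (e i) y * g y (e i))"
    using arg_cong[OF eigenbasis_expansion[OF y], of "g y"] by (simp only: g.right.sum g.scale_right)
  moreover have "h y y = (\<Sum>i<dim E. g (e i) y * h y (e i))"
    using arg_cong[OF eigenbasis_expansion[OF y], of "h y"] by (simp only: h.right.sum h.scale_right)
  ultimately have "h y y - of_real t * g y y
      = (\<Sum>i<dim E. g (e i) y * (h y (e i) - of_real t * g y (e i)))"
    by (simp only: right_diff_distrib sum_subtractf sum_distrib_left
        mult.left_commute[of _ "of_real t"])
  also have "\<dots> = (\<Sum>i<dim E. of_real ((\<mu> i - t) * (cmod (g (e i) y))\<^sup>2))"
  proof (intro sum.cong refl)
    fix i assume "i \<in> {..<dim E}"
    then have "h y (e i) - of_real t * g y (e i) = of_real (\<mu> i - t) * cnj (g (e i) y)"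
      using y g.hermitian[of y "e i"] by (simp add: eigenbasis_h_right left_diff_distrib)
    then show "g (e i) y * (h y (e i) - of_real t * g y (e i))
        = of_real ((\<mu> i - t) * (cmod (g (e i) y))\<^sup>2)"
      by (simp only: of_real_mult complex_norm_square mult.left_commute)
  qed
  finally have "Re (h y y - of_real t * g y y) = (\<Sum>i<dim E. (\<mu> i - t) * (cmod (g (e i) y))\<^sup>2)"
    by simp
  then show ?thesis by simp
qed

lemma eigenbasis_rayleigh_ge:
  assumes "y \<in> E" "E \<subseteq> V" "y \<noteq> 0" "\<And>i. i < dim E \<Longrightarrow> g (e i) y \<noteq> 0 \<Longrightarrow> t \<le> \<mu> i"
  shows "t \<le> rayleigh y"
proof -
  have "0 \<le> Re (h y y) - t * Re (g y y)"
    unfolding form_eigenbasis_expansion[OF assms(1)] using assms(4)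
    by (intro sum_nonneg) (auto simp: zero_le_mult_iff)
  moreover have "Re (g y y) > 0" using assms(1-3) by (intro g_pos) auto
  ultimately show ?thesis by (simp add: rayleigh_def pos_le_divide_eq)
qed

lemma eigenbasis_rayleigh_le:
  assumes "y \<in> E" "E \<subseteq> V" "y \<noteq> 0" "\<And>i. i < dim E \<Longrightarrow> g (e i) y \<noteq> 0 \<Longrightarrow> \<mu> i \<le> t"
  shows "rayleigh y \<le> t"
proof -
  have "Re (h y y) - t * Re (g y y) \<le> 0"
    unfolding form_eigenbasis_expansion[OF assms(1)] using assms(4)
    by (intro sum_nonpos) (auto simp: mult_le_0_iff)
  moreover have "Re (g y y) > 0" using assms(1-3) by (intro g_pos) auto
  ultimately show ?thesis by (simp add: rayleigh_def pos_divide_le_eq)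
qed

end

lemma eigenbasis_Cons:
  assumes E: "subspace E" "E \<subseteq> V"
    and u: "u \<in> eigenspace E (of_real r)" "g u u = 1" "\<And>x. x \<in> E \<Longrightarrow> x \<noteq> 0 \<Longrightarrow> r \<le> rayleigh x"
    and basis: "eigenbasis {x \<in> E. g u x = 0} e \<mu>" (is "eigenbasis ?F e \<mu>")
  shows "eigenbasis E (case_nat u e) (case_nat r \<mu>)"
proof -
  have uE: "u \<in> E" using u(1) by (simp add: eigenspace_def)
  have F_V: "?F \<subseteq> V" using E(2) by auto
  have dim: "dim E = Suc (dim ?F)"
    using E uE u(2) by (intro dim_functional_kernel g.linear_right finite_dim_subset_V) auto
  have orth_u: "g u (e i) = 0" "g (e i) u = 0" if "i < dim ?F" for i
    using eigenbasis_mem[OF basis that] g.eq_0_commute[of u] by auto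
  show ?thesis
    unfolding eigenbasis_def dim
  proof (intro conjI allI impI ballI)
    fix i assume i: "i < Suc (dim ?F)"
    show "case_nat u e i \<in> eigenspace E (of_real (case_nat r \<mu> i))"
      using i u(1) eigenspace_orthogonal_complement[OF E(1) u(1,2) eigenbasis_eigenspace[OF basis]]
      by (cases i) auto
    fix j assume j: "j < Suc (dim ?F)"
    show "g (case_nat u e i) (case_nat u e j) = of_bool (i = j)"
      using i j u(2) orth_u eigenbasis_orthonormal[OF basis] by (cases i; cases j) auto
  next
    fix i j assume ij: "i \<le> j" "j < Suc (dim ?F)"
    have "r \<le> \<mu> k" if "k < dim ?F" for k
      using u(3)[of "e k"] eigenbasis_mem[OF basis that] eigenbasis_nonzero[OF basis that]
        eigenbasis_rayleigh[OF basis that F_V] by auto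
    then show "case_nat r \<mu> i \<le> case_nat r \<mu> j"
      using ij eigenbasis_mono[OF basis] by (cases i; cases j) auto
  next
    fix y assume y: "y \<in> E"
    let ?z = "y - g u y \<cdot> u"
    have "?z = (\<Sum>i<dim ?F. g (e i) ?z \<cdot> e i)"
      using orthogonal_remainder[OF E(1) uE u(2) y] by (rule eigenbasis_expansion[OF basis])
    also have "\<dots> = (\<Sum>i<dim ?F. g (e i) y \<cdot> e i)"
      using orth_u(2) by (intro sum.cong) (auto simp: g.right.diff g.scale_right)
    finally show "y = (\<Sum>i<Suc (dim ?F). g (case_nat u e i) y \<cdot> case_nat u e i)"
      unfolding sum.lessThan_Suc_shift by (simp add: diff_eq_eq add.commute)
  qed
qed

theorem eigenbasis_exists:
  assumes "subspace E" "E \<subseteq> V"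
  shows "\<exists>e \<mu>. eigenbasis E e \<mu>"
  using assms
proof (induction "dim E" arbitrary: E rule: less_induct)
  case less
  show ?case
  proof (cases "E = {0}")
    case True
    then have "dim E = 0" using dim_le_card[of E "{}"] by simp
    with True have "eigenbasis E e \<mu>" for e \<mu> by (simp add: eigenbasis_def)
    then show ?thesis by blast
  next
    case False
    obtain u where u: "u \<in> eigenspace E (of_real (rayleigh u))" "g u u = 1"
        "\<And>x. x \<in> E \<Longrightarrow> x \<noteq> 0 \<Longrightarrow> rayleigh u \<le> rayleigh x"
      by (rule normalized_min_eigenvector[OF less.prems False]) (rule that)
    let ?F = "{x \<in> E. g u x = 0}"
    have "dim E = Suc (dim ?F)"
      using u less.prems
      by (intro dim_functional_kernel g.linear_right finite_dim_subset_V) (auto simp: eigenspace_def)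
    moreover have "subspace ?F"
      using g.linear_right less.prems(1) by (rule subspace_functional_kernel)
    ultimately obtain e \<mu> where "eigenbasis ?F e \<mu>"
      using less.hyps[of ?F] less.prems(2) by auto
    then show ?thesis using eigenbasis_Cons[OF less.prems u] by blast
  qed
qed

subsection \<open>Cauchy interlacing\<close>

lemma exists_orthogonal_vector:
  assumes "subspace U" "U \<subseteq> V" "finite A" "card A < dim U"
  shows "\<exists>y\<in>U. y \<noteq> 0 \<and> (\<forall>v\<in>A. g v y = 0)"
proof -
  have "\<exists>y\<in>U. y \<noteq> 0 \<and> (\<forall>\<phi>\<in>g ` A. \<phi> y = 0)"
    using assms card_image_le[OF assms(3), of g]
    by (intro exists_common_zero) (auto intro: g.linear_right finite_dim_subset_V)
  then show ?thesis by blast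
qed

text \<open>At most \<open>i + (dim F - 1 - j)\<close> orthogonality conditions leave a nonzero vector of \<open>U\<close> whose
  Rayleigh quotient separates the two eigenvalues.\<close>
lemma eigenvalue_le_on_common_subspace:
  assumes U: "subspace U" "U \<subseteq> E" "U \<subseteq> F" and V: "E \<subseteq> V" "F \<subseteq> V"
    and e: "eigenbasis E e \<mu>" and d: "eigenbasis F d \<nu>"
    and j: "j < dim F" and count: "i + dim F \<le> dim U + j"
  shows "\<mu> i \<le> \<nu> j"
proof -
  let ?A = "e ` {..<i} \<union> d ` {j<..<dim F}"
  have "card ?A \<le> i + (dim F - Suc j)"
    by (intro order_trans[OF card_Un_le] add_mono order_trans[OF card_image_le]) auto
  then have "card ?A < dim U" using j count by linarith
  then obtain y where y: "y \<in> U" "y \<noteq> 0" and orth: "\<forall>v\<in>?A. g v y = 0"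
    using exists_orthogonal_vector[of U ?A] U V by blast
  have "\<mu> i \<le> rayleigh y"
  proof (rule eigenbasis_rayleigh_ge[OF e])
    fix k assume k: "k < dim E" "g (e k) y \<noteq> 0"
    then have "i \<le> k" using orth by (metis UnI1 imageI lessThan_iff not_le)
    then show "\<mu> i \<le> \<mu> k" using k(1) by (rule eigenbasis_mono[OF e])
  qed (use y U V in auto)
  also have "rayleigh y \<le> \<nu> j"
  proof (rule eigenbasis_rayleigh_le[OF d])
    fix k assume k: "k < dim F" "g (d k) y \<noteq> 0"
    then have "k \<le> j" using orth by (metis UnI2 imageI greaterThanLessThan_iff not_le)
    then show "\<nu> k \<le> \<nu> j" using j by (rule eigenbasis_mono[OF d])
  qed (use y U V in auto)
  finally show ?thesis .
qed

theorem Cauchy_interlacing: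
  assumes "subspace U" "U \<subseteq> E" "E \<subseteq> V" "dim E = dim U + k"
    and "eigenbasis E e \<mu>" "eigenbasis U d \<nu>" "n < dim U"
  shows "\<mu> n \<le> \<nu> n" and "\<nu> n \<le> \<mu> (n + k)"
proof -
  have "U \<subseteq> V" using assms(2,3) by (rule subset_trans)
  show "\<mu> n \<le> \<nu> n"
    using assms(7) by (intro eigenvalue_le_on_common_subspace[OF assms(1,2) order_refl
        assms(3) \<open>U \<subseteq> V\<close> assms(5,6)]) auto
  show "\<nu> n \<le> \<mu> (n + k)"
    using assms(4,7) by (intro eigenvalue_le_on_common_subspace[OF assms(1) order_refl
        assms(2) \<open>U \<subseteq> V\<close> assms(3,6,5)]) auto
qed

end

subsection \<open>Multisets of function values\<close>

lemma sum_replicate_mset_card_fibres: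
  assumes "finite S"
  shows "(\<Sum>a\<in>\<phi> ` S. replicate_mset (card {i \<in> S. \<phi> i = a}) a) = image_mset \<phi> (mset_set S)"
proof (rule multiset_eqI)
  fix b
  have "count (\<Sum>a\<in>\<phi> ` S. replicate_mset (card {i \<in> S. \<phi> i = a}) a) b
      = (\<Sum>a\<in>\<phi> ` S. if a = b then card {i \<in> S. \<phi> i = a} else 0)"
    unfolding count_sum by (intro sum.cong) auto
  also have "\<dots> = card {i \<in> S. \<phi> i = b}"
    using assms by (auto simp: image_iff)
  also have "{i \<in> S. \<phi> i = b} = \<phi> -` {b} \<inter> S" by auto
  also have "card \<dots> = count (image_mset \<phi> (mset_set S)) b"
    using assms by (simp add: count_image_mset)
  finally show "count (\<Sum>a\<in>\<phi> ` S. replicate_mset (card {i \<in> S. \<phi> i = a}) a) b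
    = count (image_mset \<phi> (mset_set S)) b" .
qed

lemma sorted_list_of_image_mset_mono:
  assumes "\<And>i j. i \<le> j \<Longrightarrow> j < m \<Longrightarrow> \<mu> i \<le> \<mu> j"
  shows "sorted_list_of_multiset (image_mset \<mu> (mset_set {..<m})) = map \<mu> [0..<m]"
proof -
  have "image_mset \<mu> (mset_set {..<m}) = mset (map \<mu> [0..<m])"
    by (simp add: atLeast0LessThan)
  moreover have "sorted (map \<mu> [0..<m])"
    using assms by (auto simp: sorted_iff_nth_mono)
  ultimately show ?thesis by (simp only: sorted_list_of_multiset_mset sorted_sort_id)
qed

subsection \<open>Finitely supported sequences\<close>

abbreviation (input) cscale :: "complex \<Rightarrow> (nat \<Rightarrow> complex) \<Rightarrow> nat \<Rightarrow> complex" where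
  "cscale \<equiv> \<lambda>c y. (\<lambda>n. c * y n)"

interpretation seq: vector_space cscale
  by unfold_locales (auto simp: plus_fun_def algebra_simps)

lemma sum_seq_apply: "(\<Sum>i\<in>A. F i) n = (\<Sum>i\<in>A. (F i n :: complex))"
  by (induction A rule: infinite_finite_induct) (simp_all add: plus_fun_def zero_fun_def)

type_synonym complex_seq = "nat \<Rightarrow> complex"

definition supported :: "nat \<Rightarrow> complex_seq set" where
  "supported N = {y. \<forall>n. n \<notin> {1..N} \<longrightarrow> y n = 0}"

definition unit_seq :: "nat \<Rightarrow> complex_seq" where
  "unit_seq n = (\<lambda>i. of_bool (i = n))"

definition trunc :: "nat \<Rightarrow> complex_seq \<Rightarrow> complex_seq" where
  "trunc N y = (\<lambda>n. if n \<in> {1..N} then y n else 0)"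

lemma subspace_supported: "seq.subspace (supported N)"
  by (auto simp: seq.subspace_def supported_def plus_fun_def zero_fun_def)

lemma unit_seq_supported: "n \<in> {1..N} \<Longrightarrow> unit_seq n \<in> supported N"
  by (auto simp: unit_seq_def supported_def)

lemma supported_subset_span: "supported N \<subseteq> seq.span (unit_seq ` {1..N})"
proof
  fix y assume y: "y \<in> supported N"
  have "(\<Sum>i=1..N. cscale (y i) (unit_seq i)) n = y n" for n
  proof -
    have "(\<Sum>i=1..N. cscale (y i) (unit_seq i)) n = (\<Sum>i=1..N. if i = n then y i else 0)"
      unfolding sum_seq_apply by (intro sum.cong) (auto simp: unit_seq_def)
    then show ?thesis using y by (simp add: supported_def)
  qed
  then have "y = (\<Sum>i=1..N. cscale (y i) (unit_seq i))" by (intro ext) simp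
  also have "\<dots> \<in> seq.span (unit_seq ` {1..N})"
    by (intro seq.span_sum seq.span_scale seq.span_base) auto
  finally show "y \<in> seq.span (unit_seq ` {1..N})" .
qed

lemma finite_dim_supported: "seq.finite_dim (supported N)"
  using supported_subset_span unfolding seq.finite_dim_def by blast

lemma linear_coordinate: "Vector_Spaces.linear cscale (*) (\<lambda>y. y n)"
  by unfold_locales (auto simp: plus_fun_def algebra_simps)

lemma dim_supported: "seq.dim (supported N) = N"
proof (induction N)
  case 0
  have "seq.dim (supported 0) \<le> card (unit_seq ` {1..0})"
    by (rule seq.dim_le_card[OF supported_subset_span]) simp
  then show ?case by simp
next
  case (Suc N)
  have "seq.dim (supported (Suc N)) = Suc (seq.dim {y \<in> supported (Suc N). y (Suc N) = 0})"
    by (rule seq.dim_functional_kernel[OF linear_coordinate subspace_supported finite_dim_supported,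
          of "unit_seq (Suc N)"]) (auto simp: supported_def unit_seq_def)
  also have "{y \<in> supported (Suc N). y (Suc N) = 0} = supported N"
    by (auto simp: supported_def le_Suc_eq)
  finally show ?case using Suc by simp
qed

lemma linear_trunc: "Vector_Spaces.linear cscale cscale (trunc N)"
  by unfold_locales (auto simp: trunc_def plus_fun_def)

subsection \<open>Solutions and boundary couplings\<close>

definition sl_op :: "(nat \<Rightarrow> real) \<Rightarrow> (nat \<Rightarrow> real) \<Rightarrow> complex_seq \<Rightarrow> complex_seq" where
  "sl_op f q y n = - (of_real (f n) * (y (n+1) - y n) - of_real (f (n-1)) * (y n - y (n-1)))
     + of_real (q n) * y n"

definition flux :: "(nat \<Rightarrow> real) \<Rightarrow> complex_seq \<Rightarrow> complex_seq" where
  "flux f y n = of_real (f n) * (y (n+1) - y n)"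

lemma sl_solution_iff:
  "sl_solution f q w N A B lam y \<longleftrightarrow>
     (\<forall>n > N + 1. y n = 0) \<and>
     (\<forall>n\<in>{1..N}. sl_op f q y n = lam * of_real (w n) * y n) \<and>
     A *v vector [y 0, flux f y 0] + B *v vector [y N, flux f y N] = 0"
  by (simp add: sl_solution_def sl_op_def flux_def)

lemma subspace_sl_solution_space: "seq.subspace (sl_solution_space f q w N A B lam)"
proof (rule seq.subspaceI)
  let ?b = "\<lambda>y n. vector [y n, flux f y n] :: complex^2"
  have b_add: "?b (y + z) n = ?b y n + ?b z n" for y z n
    by (simp add: vec_eq_iff forall_2 flux_def algebra_simps)
  have b_scale: "?b (cscale c y) n = c *s ?b y n" for c y n
    by (simp add: vec_eq_iff forall_2 flux_def algebra_simps)
  show "0 \<in> sl_solution_space f q w N A B lam"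
    using b_scale[of 0 0] by (simp add: sl_solution_space_def sl_solution_iff sl_op_def zero_fun_def)
  show "y + z \<in> sl_solution_space f q w N A B lam"
    if "y \<in> sl_solution_space f q w N A B lam" "z \<in> sl_solution_space f q w N A B lam" for y z
  proof -
    have "sl_op f q (y + z) n = sl_op f q y n + sl_op f q z n" for n
      by (simp add: sl_op_def algebra_simps)
    moreover have "A *v ?b (y + z) 0 + B *v ?b (y + z) N
        = (A *v ?b y 0 + B *v ?b y N) + (A *v ?b z 0 + B *v ?b z N)"
      by (simp only: b_add matrix_vector_right_distrib add_ac)
    ultimately show ?thesis
      using that by (simp add: sl_solution_space_def sl_solution_iff distrib_left)
  qed
  show "cscale c y \<in> sl_solution_space f q w N A B lam"
    if "y \<in> sl_solution_space f q w N A B lam" for c y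
  proof -
    have "sl_op f q (cscale c y) n = c * sl_op f q y n" for n
      by (simp add: sl_op_def algebra_simps)
    moreover have "A *v ?b (cscale c y) 0 + B *v ?b (cscale c y) N = c *s (A *v ?b y 0 + B *v ?b y N)"
      by (simp only: b_scale vector_scalar_commute vector_add_ldistrib)
    ultimately show ?thesis
      using that by (simp add: sl_solution_space_def sl_solution_iff del: vector_add_ldistrib)
  qed
qed

lemma inj_on_trunc_solutions:
  assumes "N \<ge> 2" "f 0 \<noteq> 0" "f N \<noteq> 0"
  shows "inj_on (trunc N) (sl_solution_space f q w N A B lam)"
proof (rule inj_onI)
  fix y z
  assume "y \<in> sl_solution_space f q w N A B lam" "z \<in> sl_solution_space f q w N A B lam"
    and trunc: "trunc N y = trunc N z"
  then have y: "\<forall>n > N + 1. y n = 0" "\<forall>n\<in>{1..N}. sl_op f q y n = lam * of_real (w n) * y n"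
    and z: "\<forall>n > N + 1. z n = 0" "\<forall>n\<in>{1..N}. sl_op f q z n = lam * of_real (w n) * z n"
    by (simp_all add: sl_solution_space_def sl_solution_iff)
  have interior: "y n = z n" if "n \<in> {1..N}" for n
    using fun_cong[OF trunc, of n] that by (simp add: trunc_def)
  have sl_op_eq: "sl_op f q y n = sl_op f q z n" if "n \<in> {1..N}" for n
    using y z interior that by simp
  have "y 0 = z 0"
    using sl_op_eq[of 1] interior[of 1] interior[of 2] assms by (simp add: sl_op_def numeral_2_eq_2)
  moreover have "y (N+1) = z (N+1)"
    using sl_op_eq[of N] interior[of "N - 1"] interior[of N] assms by (simp add: sl_op_def)
  moreover have "n = 0 \<or> n \<in> {1..N} \<or> n = N + 1 \<or> n > N + 1" for n by auto
  ultimately show "y = z" using interior y z by (metis ext)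
qed

text \<open>For \<open>f 0 \<noteq> 0\<close>, the boundary condition restated for \<open>(y 1, flux f y 0)\<close> instead of
  \<open>(y 0, flux f y 0)\<close>: now \<open>y 0\<close> enters through the flux only.\<close>
definition interior_coupling :: "real \<Rightarrow> real^2^2 \<Rightarrow> real^2^2" where
  "interior_coupling f0 L = L ** mat22 1 (- 1 / f0) 0 1"

lemma interior_coupling_nth:
  "interior_coupling f0 L $ i $ 1 = L $ i $ 1"
  "interior_coupling f0 L $ i $ 2 = L $ i $ 2 - L $ i $ 1 / f0"
  by (simp_all add: interior_coupling_def matrix_matrix_mult_def sum_2 mat22_def)

lemma interior_coupling_12_eq_0_iff:
  "f0 \<noteq> 0 \<Longrightarrow> interior_coupling f0 L $ 1 $ 2 = 0 \<longleftrightarrow> f0 * L$1$2 = L$1$1"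
  by (auto simp: interior_coupling_nth field_simps)

lemma interior_coupling_diff:
  "interior_coupling f0 (K - L) = interior_coupling f0 K - interior_coupling f0 L"
  by (simp add: interior_coupling_def matrix_matrix_mult_def vec_eq_iff
      left_diff_distrib sum_subtractf)

lemma det_interior_coupling: "det (interior_coupling f0 L) = det L"
proof -
  have "det (mat22 1 (- 1 / f0) 0 1) = 1" by (simp add: det_2 mat22_def)
  then show ?thesis by (simp add: interior_coupling_def det_mul)
qed

definition coupled :: "real \<Rightarrow> real^2^2 \<Rightarrow> complex \<Rightarrow> complex \<Rightarrow> complex \<Rightarrow> complex \<Rightarrow> bool" where
  "coupled \<gamma> M u p v r \<longleftrightarrow>
     v = cis \<gamma> * (of_real (M$1$1) * u + of_real (M$1$2) * p) \<and>
     r = cis \<gamma> * (of_real (M$2$1) * u + of_real (M$2$2) * p)"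

lemma sl_boundary_condition_iff_coupled:
  assumes "f 0 \<noteq> 0"
  shows "cis_mat \<gamma> L *v vector [y 0, flux f y 0] + (- mat 1) *v vector [y N, flux f y N] = 0
    \<longleftrightarrow> coupled \<gamma> (interior_coupling (f 0) L) (y 1) (flux f y 0) (y N) (flux f y N)"
proof -
  have "(cis_mat \<gamma> L *v vector [u, p] + (- mat 1) *v vector [v, r] = 0) \<longleftrightarrow>
    v = cis \<gamma> * (of_real (L$1$1) * u + of_real (L$1$2) * p) \<and>
    r = cis \<gamma> * (of_real (L$2$1) * u + of_real (L$2$2) * p)" for u p v r :: complex
    by (simp add: vec_eq_iff forall_2 matrix_vector_mult_def sum_2 cis_mat_def mat_def
        algebra_simps eq_commute[of v] eq_commute[of r])
  moreover have "of_real (L$i$1) * y 0 + of_real (L$i$2) * flux f y 0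
      = of_real (interior_coupling (f 0) L $ i $ 1) * y 1
        + of_real (interior_coupling (f 0) L $ i $ 2) * flux f y 0" for i
    using assms by (simp add: interior_coupling_nth flux_def field_simps)
  ultimately show ?thesis unfolding coupled_def by simp
qed

lemma of_real_det_2:
  fixes M :: "real^2^2"
  shows "of_real (M$1$1) * of_real (M$2$2) - of_real (M$1$2) * of_real (M$2$1)
    = (of_real (det M) :: complex)"
  by (simp add: det_2)

lemma coupled_iff_lagrangian:
  assumes "det M = 1"
  shows "coupled \<gamma> M u p v r \<longleftrightarrow>
    (\<forall>u' p' v' r'. coupled \<gamma> M u' p' v' r' \<longrightarrow> cnj u' * p - cnj v' * r = cnj p' * u - cnj r' * v)"
proof -
  note det = of_real_det_2[of M, unfolded assms of_real_1]
  have cis: "cis \<gamma> * cis (- \<gamma>) = 1" by (simp add: cis_mult)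
  show ?thesis
  proof
    assume uv: "coupled \<gamma> M u p v r"
    show "\<forall>u' p' v' r'. coupled \<gamma> M u' p' v' r' \<longrightarrow> cnj u' * p - cnj v' * r = cnj p' * u - cnj r' * v"
    proof (intro allI impI)
      fix u' p' v' r' assume "coupled \<gamma> M u' p' v' r'"
      then have "cnj v' = cis (- \<gamma>) * (of_real (M$1$1) * cnj u' + of_real (M$1$2) * cnj p')"
        "cnj r' = cis (- \<gamma>) * (of_real (M$2$1) * cnj u' + of_real (M$2$2) * cnj p')"
        by (simp_all add: coupled_def cis_cnj)
      with uv show "cnj u' * p - cnj v' * r = cnj p' * u - cnj r' * v"
        unfolding coupled_def using det cis by algebra
    qed
  next
    assume lagrangian: "\<forall>u' p' v' r'. coupled \<gamma> M u' p' v' r' \<longrightarrow>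
      cnj u' * p - cnj v' * r = cnj p' * u - cnj r' * v"
    have "p - cis (- \<gamma>) * of_real (M$1$1) * r = - cis (- \<gamma>) * of_real (M$2$1) * v"
      using lagrangian[rule_format, of 1 0 "cis \<gamma> * of_real (M$1$1)" "cis \<gamma> * of_real (M$2$1)"]
      by (simp add: coupled_def cis_cnj)
    moreover have "- cis (- \<gamma>) * of_real (M$1$2) * r = u - cis (- \<gamma>) * of_real (M$2$2) * v"
      using lagrangian[rule_format, of 0 1 "cis \<gamma> * of_real (M$1$2)" "cis \<gamma> * of_real (M$2$2)"]
      by (simp add: coupled_def cis_cnj)
    ultimately show "coupled \<gamma> M u p v r"
      unfolding coupled_def using det cis by algebra
  qed
qed

subsection \<open>Weak formulation\<close>

locale sturm_liouville =
  fixes f q w :: "nat \<Rightarrow> real" and N :: nat and \<gamma> :: real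
  assumes N: "N \<ge> 2" and f0: "f 0 \<noteq> 0" and fN: "f N \<noteq> 0"
    and w_pos: "n \<in> {1..N} \<Longrightarrow> w n > 0"
begin

definition energy :: "complex_seq \<Rightarrow> complex_seq \<Rightarrow> complex" where
  "energy x y = (\<Sum>n=1..<N. of_real (f n) * cnj (x (n+1) - x n) * (y (n+1) - y n))
     + (\<Sum>n=1..N. of_real (q n) * cnj (x n) * y n)"

definition weight :: "complex_seq \<Rightarrow> complex_seq \<Rightarrow> complex" where
  "weight x y = (\<Sum>n=1..N. of_real (w n) * cnj (x n) * y n)"

lemma energy_cong: "\<forall>n\<in>{1..N}. y n = z n \<Longrightarrow> energy x y = energy x z"
  unfolding energy_def by (intro arg_cong2[of _ _ _ _ "(+)"] sum.cong) auto

lemma weight_cong: "\<forall>n\<in>{1..N}. y n = z n \<Longrightarrow> weight x y = weight x z"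
  unfolding weight_def by (intro sum.cong) auto

lemma sl_op_summation_by_parts:
  "(\<Sum>n=1..N. cnj (x n) * sl_op f q y n) = energy x y + cnj (x 1) * flux f y 0 - cnj (x N) * flux f y N"
proof -
  have "(\<Sum>n=1..m. cnj (x n) * sl_op f q y n)
      = (\<Sum>n=1..<m. of_real (f n) * cnj (x (n+1) - x n) * (y (n+1) - y n))
        + (\<Sum>n=1..m. of_real (q n) * cnj (x n) * y n) + cnj (x 1) * flux f y 0 - cnj (x m) * flux f y m"
    if "m \<ge> 1" for m
    using that
    by (induction m rule: dec_induct) (simp_all add: sl_op_def flux_def algebra_simps)
  then show ?thesis using N by (simp add: energy_def)
qed

text \<open>The fluxes \<open>p\<close> and \<open>r\<close> stand for the values \<open>y 0\<close> and \<open>y (N + 1)\<close> outside \<open>{1..N}\<close>.\<close>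
definition form_domain :: "real^2^2 \<Rightarrow> complex_seq set" where
  "form_domain L = {y \<in> supported N. \<exists>p r. coupled \<gamma> (interior_coupling (f 0) L) (y 1) p (y N) r}"

definition boundary_form_of ::
  "(complex_seq \<Rightarrow> complex_seq \<Rightarrow> complex) \<Rightarrow> real^2^2 \<Rightarrow> bool" where
  "boundary_form_of \<beta> L \<longleftrightarrow> (\<forall>y\<in>form_domain L. \<exists>p r.
     coupled \<gamma> (interior_coupling (f 0) L) (y 1) p (y N) r
     \<and> (\<forall>x. \<beta> x y = cnj (x 1) * p - cnj (x N) * r))"

abbreviation solutions :: "real^2^2 \<Rightarrow> complex \<Rightarrow> complex_seq set" where
  "solutions L lam \<equiv> sl_solution_space f q w N (cis_mat \<gamma> L) (- mat 1) lam"

definition weak_solutions ::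
  "(complex_seq \<Rightarrow> complex_seq \<Rightarrow> complex) \<Rightarrow> real^2^2 \<Rightarrow> complex \<Rightarrow> complex_seq set" where
  "weak_solutions \<beta> L lam =
     {y \<in> form_domain L. \<forall>x\<in>form_domain L. energy x y + \<beta> x y = lam * weight x y}"

definition residual :: "complex \<Rightarrow> complex_seq \<Rightarrow> complex_seq" where
  "residual lam y n = sl_op f q y n - lam * of_real (w n) * y n"

lemma solutions_iff:
  "y \<in> solutions L lam \<longleftrightarrow> (\<forall>n > N + 1. y n = 0) \<and> (\<forall>n\<in>{1..N}. residual lam y n = 0) \<and>
     coupled \<gamma> (interior_coupling (f 0) L) (y 1) (flux f y 0) (y N) (flux f y N)"
  by (simp add: sl_solution_space_def sl_solution_iff sl_boundary_condition_iff_coupled[of f, OF f0]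
      residual_def)

lemma sum_residual:
  "(\<Sum>n=1..N. cnj (x n) * residual lam y n)
     = energy x y + cnj (x 1) * flux f y 0 - cnj (x N) * flux f y N - lam * weight x y"
  unfolding sl_op_summation_by_parts[symmetric] residual_def weight_def
  by (simp add: right_diff_distrib sum_subtractf sum_distrib_left mult_ac)

text \<open>Symmetry of the coupling lets \<open>\<beta>\<close> be evaluated through the fluxes of its first argument.\<close>
lemma boundary_form_coupled:
  assumes \<beta>: "boundary_form_of \<beta> L" and L: "det L = 1"
    and y: "y \<in> form_domain L" and x: "coupled \<gamma> (interior_coupling (f 0) L) (x 1) p (x N) r"
  shows "\<beta> x y = cnj p * y 1 - cnj r * y N"
proof -
  let ?M = "interior_coupling (f 0) L"
  obtain p' r' where y': "coupled \<gamma> ?M (y 1) p' (y N) r'" "\<beta> x y = cnj (x 1) * p' - cnj (x N) * r'"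
    using \<beta> y unfolding boundary_form_of_def by blast
  have "det ?M = 1" using L by (simp add: det_interior_coupling)
  then have "cnj (x 1) * p' - cnj (x N) * r' = cnj p * y 1 - cnj r * y N"
    using x y'(1) coupled_iff_lagrangian by blast
  then show ?thesis using y'(2) by simp
qed

lemma trunc_solution_weak:
  assumes \<beta>: "boundary_form_of \<beta> L" and L: "det L = 1" and Y: "Y \<in> solutions L lam"
  shows "trunc N Y \<in> weak_solutions \<beta> L lam"
proof -
  let ?M = "interior_coupling (f 0) L" and ?y = "trunc N Y"
  have coupled: "coupled \<gamma> ?M (Y 1) (flux f Y 0) (Y N) (flux f Y N)"
    using Y by (simp add: solutions_iff)
  have y: "?y \<in> supported N" "\<forall>n\<in>{1..N}. ?y n = Y n" "?y 1 = Y 1" "?y N = Y N"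
    using N by (auto simp: trunc_def supported_def)
  then have dom: "?y \<in> form_domain L" using coupled by (auto simp: form_domain_def)
  have "energy x ?y + \<beta> x ?y = lam * weight x ?y" if "x \<in> form_domain L" for x
  proof -
    from that obtain p r where x: "coupled \<gamma> ?M (x 1) p (x N) r"
      by (auto simp: form_domain_def)
    have "det ?M = 1" using L by (simp add: det_interior_coupling)
    with x coupled have "cnj (x 1) * flux f Y 0 - cnj (x N) * flux f Y N = cnj p * Y 1 - cnj r * Y N"
      using coupled_iff_lagrangian by blast
    also have "\<dots> = \<beta> x ?y"
      using boundary_form_coupled[OF \<beta> L dom x] y(3,4) by simp
    finally have "energy x Y + \<beta> x ?y - lam * weight x Y = (\<Sum>n=1..N. cnj (x n) * residual lam Y n)"
      unfolding sum_residual by simp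
    also have "\<dots> = 0" using Y by (simp add: solutions_iff)
    finally show ?thesis using energy_cong[OF y(2)] weight_cong[OF y(2)] by simp
  qed
  then show ?thesis using dom by (simp add: weak_solutions_def)
qed

lemma extension_solving_ends:
  assumes "y \<in> supported N"
  obtains Y where "\<forall>n\<in>{1..N}. Y n = y n" "\<forall>n > N + 1. Y n = 0"
    "residual lam Y 1 = 0" "residual lam Y N = 0"
proof -
  define p where "p = lam * of_real (w 1) * y 1 - of_real (q 1) * y 1 + of_real (f 1) * (y 2 - y 1)"
  define r where "r = of_real (f (N-1)) * (y N - y (N-1)) + of_real (q N) * y N
    - lam * of_real (w N) * y N"
  define Y where "Y n = (if n = 0 then y 1 - p / of_real (f 0)
    else if n = N + 1 then y N + r / of_real (f N) else y n)" for n
  have "residual lam Y 1 = 0"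
    using N f0 by (simp add: residual_def sl_op_def Y_def p_def numeral_2_eq_2)
  moreover have "residual lam Y N = 0"
    using N fN by (auto simp: residual_def sl_op_def Y_def r_def)
  ultimately show ?thesis
    using assms by (intro that[of Y]) (auto simp: Y_def supported_def)
qed

lemma sum_residual_weak_solution:
  assumes y: "y \<in> weak_solutions \<beta> L lam" and Y: "\<forall>n\<in>{1..N}. Y n = y n" and x: "x \<in> form_domain L"
  shows "(\<Sum>n=1..N. cnj (x n) * residual lam Y n)
    = cnj (x 1) * flux f Y 0 - cnj (x N) * flux f Y N - \<beta> x y"
proof -
  have "energy x Y + \<beta> x y = lam * weight x Y"
    using y x energy_cong[OF Y] weight_cong[OF Y] by (simp add: weak_solutions_def)
  then show ?thesis unfolding sum_residual by algebra
qed

lemma residual_weak_solution_interior: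
  assumes \<beta>: "boundary_form_of \<beta> L" and L: "det L = 1"
    and y: "y \<in> weak_solutions \<beta> L lam" and Y: "\<forall>n\<in>{1..N}. Y n = y n"
    and n: "n \<in> {1..N} - {1, N}"
  shows "residual lam Y n = 0"
proof -
  have ends: "unit_seq n 1 = 0" "unit_seq n N = 0" using n by (auto simp: unit_seq_def)
  then have zero: "coupled \<gamma> (interior_coupling (f 0) L) (unit_seq n 1) 0 (unit_seq n N) 0"
    by (simp add: coupled_def del: One_nat_def)
  then have dom: "unit_seq n \<in> form_domain L"
    using n unit_seq_supported[of n N] by (auto simp: form_domain_def)
  have "\<beta> (unit_seq n) y = 0"
    using boundary_form_coupled[OF \<beta> L _ zero] y by (simp add: weak_solutions_def)
  then have "(\<Sum>i=1..N. cnj (unit_seq n i) * residual lam Y i) = 0"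
    unfolding sum_residual_weak_solution[OF y Y dom] ends by simp
  moreover have "(\<Sum>i=1..N. cnj (unit_seq n i) * residual lam Y i)
      = (\<Sum>i=1..N. if i = n then residual lam Y i else 0)"
    by (intro sum.cong) (auto simp: unit_seq_def)
  ultimately show ?thesis using n by simp
qed

lemma weak_solution_extends:
  assumes \<beta>: "boundary_form_of \<beta> L" and L: "det L = 1" and y: "y \<in> weak_solutions \<beta> L lam"
  shows "y \<in> trunc N ` solutions L lam"
proof -
  let ?M = "interior_coupling (f 0) L"
  have dom: "y \<in> form_domain L" "y \<in> supported N"
    using y by (simp_all add: weak_solutions_def form_domain_def)
  obtain Y where Y: "\<forall>n\<in>{1..N}. Y n = y n" "\<forall>n > N + 1. Y n = 0"
      "residual lam Y 1 = 0" "residual lam Y N = 0"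
    by (rule extension_solving_ends[OF dom(2)])
  have residual: "residual lam Y n = 0" if "n \<in> {1..N}" for n
    using residual_weak_solution_interior[OF \<beta> L y Y(1), of n] Y(3,4) that by blast
  have "cnj u * flux f Y 0 - cnj v * flux f Y N = cnj p * Y 1 - cnj r * Y N"
    if upvr: "coupled \<gamma> ?M u p v r" for u p v r
  proof -
    define x where "x = (\<lambda>n. if n = 1 then u else if n = N then v else 0)"
    have x: "x 1 = u" "x N = v" "x \<in> supported N" using N by (auto simp: x_def supported_def)
    then have "x \<in> form_domain L" using upvr by (auto simp: form_domain_def)
    then have "\<beta> x y = cnj u * flux f Y 0 - cnj v * flux f Y N"
      using sum_residual_weak_solution[OF y Y(1), of x] residual x by simp
    then show ?thesis
      using boundary_form_coupled[OF \<beta> L dom(1), of x p r] upvr x Y(1) N by simp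
  qed
  then have "coupled \<gamma> ?M (Y 1) (flux f Y 0) (Y N) (flux f Y N)"
    using L by (subst coupled_iff_lagrangian) (auto simp: det_interior_coupling)
  then have "Y \<in> solutions L lam" using Y(2) residual by (simp add: solutions_iff)
  moreover have "trunc N Y = y" using Y(1) dom(2) by (auto simp: trunc_def supported_def)
  ultimately show ?thesis by blast
qed

theorem trunc_solutions_eq_weak_solutions:
  assumes "boundary_form_of \<beta> L" "det L = 1"
  shows "trunc N ` solutions L lam = weak_solutions \<beta> L lam"
  using trunc_solution_weak[OF assms] weak_solution_extends[OF assms] by blast

lemma subspace_form_domain: "seq.subspace (form_domain L)"
proof (rule seq.subspaceI)
  let ?C = "coupled \<gamma> (interior_coupling (f 0) L)"
  note supported = subspace_supported[of N]
  have "?C (0 1) 0 (0 N) 0" by (simp add: coupled_def)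
  then show "0 \<in> form_domain L"
    using seq.subspace_0[OF supported] by (auto simp: form_domain_def)
  show "y + z \<in> form_domain L" if "y \<in> form_domain L" "z \<in> form_domain L" for y z
  proof -
    from that obtain p r p' r' where "?C (y 1) p (y N) r" "?C (z 1) p' (z N) r'"
      by (auto simp: form_domain_def)
    then have "?C ((y + z) 1) (p + p') ((y + z) N) (r + r')" by (simp add: coupled_def algebra_simps)
    then show ?thesis using that seq.subspace_add[OF supported] by (auto simp: form_domain_def)
  qed
  show "cscale c y \<in> form_domain L" if "y \<in> form_domain L" for c y
  proof -
    from that obtain p r where "?C (y 1) p (y N) r" by (auto simp: form_domain_def)
    then have "?C (c * y 1) (c * p) (c * y N) (c * r)" by (simp add: coupled_def algebra_simps)
    then show ?thesis using that seq.subspace_scale[OF supported] by (auto simp: form_domain_def)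
  qed
qed

lemma form_domain_singular:
  assumes "f 0 * L$1$2 = L$1$1"
  shows "form_domain L = {y \<in> supported N. y N - cis \<gamma> * of_real (L$1$1) * y 1 = 0}"
proof -
  have "interior_coupling (f 0) L $ 1 $ 2 = 0"
    using assms f0 by (simp add: interior_coupling_12_eq_0_iff)
  then show ?thesis by (auto simp: form_domain_def coupled_def interior_coupling_nth(1) mult.assoc)
qed

lemma dim_form_domain_singular:
  assumes "f 0 * L$1$2 = L$1$1"
  shows "seq.dim (form_domain L) = N - 1"
proof -
  let ?\<phi> = "\<lambda>y :: nat \<Rightarrow> complex. y N - cis \<gamma> * of_real (L$1$1) * y 1"
  have "seq.dim (supported N) = Suc (seq.dim (form_domain L))"
    unfolding form_domain_singular[OF assms]
  proof (rule seq.dim_functional_kernel[OF _ subspace_supported finite_dim_supported])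
    show "Vector_Spaces.linear cscale (*) ?\<phi>"
      by unfold_locales (auto simp: plus_fun_def algebra_simps)
    show "unit_seq N \<in> supported N" using N by (simp add: unit_seq_supported)
    show "?\<phi> (unit_seq N) \<noteq> 0" using N by (simp add: unit_seq_def)
  qed
  then show ?thesis by (simp add: dim_supported)
qed

lemma weight_hermitian: "weight x y = cnj (weight y x)"
  unfolding weight_def cnj_sum by (intro sum.cong) (auto simp: mult_ac)

lemma energy_hermitian: "energy x y = cnj (energy y x)"
  unfolding energy_def cnj_sum complex_cnj_add
  by (intro arg_cong2[of _ _ _ _ "(+)"] sum.cong) (auto simp: mult_ac)

lemma weight_pos:
  assumes "x \<in> supported N" "x \<noteq> 0"
  shows "Re (weight x x) > 0"
proof -
  obtain n where n: "x n \<noteq> 0" using assms(2) by (auto simp: fun_eq_iff)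
  then have nN: "n \<in> {1..N}" using assms(1) by (auto simp: supported_def)
  have "Re (weight x x) = (\<Sum>n=1..N. w n * (cmod (x n))\<^sup>2)"
    unfolding weight_def Re_sum
    by (intro sum.cong refl) (simp add: cmod_power2, simp add: power2_eq_square algebra_simps)
  also have "\<dots> > 0"
    using n nN w_pos by (intro sum_pos2[OF _ nN] mult_nonneg_nonneg less_imp_le[OF w_pos]) auto
  finally show ?thesis .
qed

end

subsection \<open>Regular and singular boundary conditions\<close>

locale regular_sturm_liouville = sturm_liouville +
  fixes K :: "real^2^2"
  assumes det_K: "det K = 1" and regular: "K$1$1 - f 0 * K$1$2 \<noteq> 0"
begin

abbreviation M :: "real^2^2" where
  "M \<equiv> interior_coupling (f 0) K"

lemma M12_nonzero: "M$1$2 \<noteq> 0"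
  using regular f0 by (simp add: interior_coupling_12_eq_0_iff)

text \<open>The boundary term \<open>cnj (x 1) * p - cnj (x N) * r\<close> with the coupling solved for \<open>p\<close> and \<open>r\<close>.\<close>
definition boundary_form :: "complex_seq \<Rightarrow> complex_seq \<Rightarrow> complex" where
  "boundary_form x y = (cis (- \<gamma>) * cnj (x 1) * y N + cis \<gamma> * cnj (x N) * y 1
     - of_real (M$1$1) * cnj (x 1) * y 1 - of_real (M$2$2) * cnj (x N) * y N) / of_real (M$1$2)"

definition form :: "complex_seq \<Rightarrow> complex_seq \<Rightarrow> complex" where
  "form x y = energy x y + boundary_form x y"

lemma boundary_form_hermitian: "boundary_form x y = cnj (boundary_form y x)"
  by (simp add: boundary_form_def cis_cnj mult_ac)

lemma boundary_form_eq_if_coupled: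
  assumes "coupled \<gamma> M (y 1) p (y N) r"
  shows "boundary_form x y = cnj (x 1) * p - cnj (x N) * r"
proof -
  note of_real_det_2[of M, unfolded det_interior_coupling det_K of_real_1]
  moreover have "cis \<gamma> * cis (- \<gamma>) = 1" by (simp add: cis_mult)
  ultimately have "of_real (M$1$2) * (cnj (x 1) * p - cnj (x N) * r) = cis (- \<gamma>) * cnj (x 1) * y N
      + cis \<gamma> * cnj (x N) * y 1 - of_real (M$1$1) * cnj (x 1) * y 1 - of_real (M$2$2) * cnj (x N) * y N"
    using assms unfolding coupled_def by algebra
  then show ?thesis
    using M12_nonzero by (simp add: boundary_form_def field_simps)
qed

lemma exists_coupled_flux: "\<exists>p r. coupled \<gamma> M u p v r"
proof (intro exI)
  let ?p = "(cis (- \<gamma>) * v - of_real (M$1$1) * u) / of_real (M$1$2)"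
  have "cis \<gamma> * (cis (- \<gamma>) * v) = v" by (simp add: cis_mult flip: mult.assoc)
  then show "coupled \<gamma> M u ?p v (cis \<gamma> * (of_real (M$2$1) * u + of_real (M$2$2) * ?p))"
    using M12_nonzero by (simp add: coupled_def)
qed

lemma form_domain_regular: "form_domain K = supported N"
  using exists_coupled_flux by (auto simp: form_domain_def)

lemma boundary_form_of_regular: "boundary_form_of boundary_form K"
  unfolding boundary_form_of_def using exists_coupled_flux boundary_form_eq_if_coupled by blast

text \<open>\<open>det (K - L) = 0\<close> means that the two boundary conditions share a nonzero vector of boundary
  values; since \<open>K\<close> is regular and \<open>L\<close> singular, its multiples reach all of \<open>form_domain L\<close>.\<close>
lemma boundary_form_of_singular:
  assumes L: "det L = 1" "f 0 * L$1$2 = L$1$1" and common: "det (K - L) = 0"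
  shows "boundary_form_of boundary_form L"
  unfolding boundary_form_of_def
proof
  let ?L = "interior_coupling (f 0) L"
  fix y assume "y \<in> form_domain L"
  then have yN: "y N = cis \<gamma> * of_real (L$1$1) * y 1"
    unfolding form_domain_singular[OF L(2)] by simp
  have L12: "?L$1$2 = 0" using L(2) f0 by (simp add: interior_coupling_12_eq_0_iff)
  define D where "D = M - ?L"
  have D12: "D$1$2 \<noteq> 0" using M12_nonzero L12 by (simp add: D_def)
  have "det D = 0"
    unfolding D_def interior_coupling_diff[symmetric] det_interior_coupling by (rule common)
  note det_D = of_real_det_2[of D, unfolded this of_real_0]
  define p where "p = - of_real (D$1$1) * y 1 / of_real (D$1$2)"
  have D_1: "of_real (D$1$1) * y 1 + of_real (D$1$2) * p = 0"
    using D12 by (simp add: p_def)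
  with det_D have "of_real (D$1$2) * (of_real (D$2$1) * y 1 + of_real (D$2$2) * p) = 0"
    by algebra
  with D12 have "of_real (D$2$1) * y 1 + of_real (D$2$2) * p = 0" by simp
  with D_1 have "coupled \<gamma> M (y 1) p (y N) r \<longleftrightarrow> coupled \<gamma> ?L (y 1) p (y N) r" for r
    unfolding coupled_def D_def by (simp add: algebra_simps)
  moreover have "coupled \<gamma> ?L (y 1) p (y N) (cis \<gamma> * (of_real (?L$2$1) * y 1 + of_real (?L$2$2) * p))"
    using yN L12 by (simp add: coupled_def interior_coupling_nth(1))
  ultimately show "\<exists>p r. coupled \<gamma> ?L (y 1) p (y N) r \<and>
      (\<forall>x. boundary_form x y = cnj (x 1) * p - cnj (x N) * r)"
    using boundary_form_eq_if_coupled by blast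
qed

sublocale pencil: hermitian_pencil cscale weight form "supported N"
proof unfold_locales
  show "weight x (y + z) = weight x y + weight x z" for x y z
    by (simp add: weight_def algebra_simps sum.distrib)
  show "weight x (cscale c y) = c * weight x y" for c x y
    by (simp add: weight_def sum_distrib_left mult_ac)
  show "form x (y + z) = form x y + form x z" for x y z
    by (simp add: form_def energy_def boundary_form_def algebra_simps sum.distrib sum_subtractf
        add_divide_distrib diff_divide_distrib)
  show "form x (cscale c y) = c * form x y" for c x y
    by (simp add: form_def energy_def boundary_form_def algebra_simps sum_distrib_left sum_subtractf
        sum.distrib add_divide_distrib diff_divide_distrib)
  show "weight x y = cnj (weight y x)" for x y by (rule weight_hermitian)
  show "form x y = cnj (form y x)" for x y
    unfolding form_def complex_cnj_add
    by (intro arg_cong2[of _ _ _ _ "(+)"] energy_hermitian boundary_form_hermitian)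
qed (use finite_dim_supported weight_pos in auto)

lemma trunc_solutions_eq_eigenspace:
  assumes "boundary_form_of boundary_form L" "det L = 1"
  shows "trunc N ` solutions L lam = pencil.eigenspace (form_domain L) lam"
  unfolding trunc_solutions_eq_weak_solutions[OF assms]
  by (simp add: weak_solutions_def pencil.eigenspace_def form_def)

lemma sl_eig_mset_eq_eigenbasis:
  assumes L: "boundary_form_of boundary_form L" "det L = 1"
    and e: "pencil.eigenbasis (form_domain L) e \<mu>"
  defines "m \<equiv> seq.dim (form_domain L)"
  shows "sl_eigenvalues f q w N (cis_mat \<gamma> L) (- mat 1) = (of_real \<circ> \<mu>) ` {..<m}"
    and "sl_eig_mset f q w N (cis_mat \<gamma> L) (- mat 1) = image_mset (of_real \<circ> \<mu>) (mset_set {..<m})"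
proof -
  let ?A = "cis_mat \<gamma> L" and ?B = "- mat 1 :: complex^2^2"
  note image = trunc_solutions_eq_eigenspace[OF L]
  note inj = inj_on_trunc_solutions[OF N f0 fN, of q w ?A ?B]
  have "(\<exists>y\<in>solutions L lam. y \<noteq> 0) \<longleftrightarrow> (\<exists>y\<in>pencil.eigenspace (form_domain L) lam. y \<noteq> 0)" for lam
  proof -
    have "trunc N y = 0 \<longleftrightarrow> y = 0" if "y \<in> solutions L lam" for y
      using inj_onD[OF inj[of lam], of y 0] that seq.subspace_0[OF subspace_sl_solution_space]
      by (auto simp: trunc_def zero_fun_def)
    then show ?thesis unfolding image[symmetric] by auto
  qed
  then show eigenvalues: "sl_eigenvalues f q w N ?A ?B = (of_real \<circ> \<mu>) ` {..<m}"
    unfolding sl_eigenvalues_def m_def using pencil.eigenvalue_iff[OF e subspace_form_domain]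
    by (auto simp: sl_solution_space_def)
  have "sl_mult f q w N ?A ?B lam = card {i \<in> {..<m}. (of_real \<circ> \<mu>) i = lam}" for lam
    using dim_image_inj_on[OF linear_trunc subspace_sl_solution_space inj, of lam]
      pencil.dim_eigenspace[OF e subspace_form_domain, of lam]
    by (simp add: sl_mult_def image m_def)
  then show "sl_eig_mset f q w N ?A ?B = image_mset (of_real \<circ> \<mu>) (mset_set {..<m})"
    unfolding sl_eig_mset_def eigenvalues by (simp only: sum_replicate_mset_card_fibres finite_lessThan)
qed

theorem sl_spectrum_eq_eigenbasis:
  assumes L: "boundary_form_of boundary_form L" "det L = 1"
    and e: "pencil.eigenbasis (form_domain L) e \<mu>"
  shows "sl_has_exactly f q w N (cis_mat \<gamma> L) (- mat 1) (seq.dim (form_domain L))"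
    and "n < seq.dim (form_domain L) \<Longrightarrow> sl_lambda f q w N (cis_mat \<gamma> L) (- mat 1) n = \<mu> n"
proof -
  note spectrum = sl_eig_mset_eq_eigenbasis[OF assms]
  show "sl_has_exactly f q w N (cis_mat \<gamma> L) (- mat 1) (seq.dim (form_domain L))"
    unfolding sl_has_exactly_def spectrum by simp
  have "image_mset Re (sl_eig_mset f q w N (cis_mat \<gamma> L) (- mat 1))
      = image_mset \<mu> (mset_set {..<seq.dim (form_domain L)})"
    unfolding spectrum(2) by (simp add: multiset.map_comp o_def)
  then show "sl_lambda f q w N (cis_mat \<gamma> L) (- mat 1) n = \<mu> n" if "n < seq.dim (form_domain L)"
    using that pencil.eigenbasis_mono[OF e] by (simp add: sl_lambda_def sorted_list_of_image_mset_mono)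
qed

theorem regular_sl_has_exactly: "sl_has_exactly f q w N (cis_mat \<gamma> K) (- mat 1) N"
proof -
  obtain e \<mu> where "pencil.eigenbasis (form_domain K) e \<mu>"
    using pencil.eigenbasis_exists[OF subspace_form_domain] form_domain_regular by blast
  then show ?thesis
    using sl_spectrum_eq_eigenbasis(1)[OF boundary_form_of_regular det_K]
    by (simp add: form_domain_regular dim_supported)
qed

theorem singular_sl_interlacing:
  assumes L: "det L = 1" "f 0 * L$1$2 = L$1$1" "det (K - L) = 0"
  shows "sl_has_exactly f q w N (cis_mat \<gamma> L) (- mat 1) (N - 1)"
    and "n \<le> N - 2 \<Longrightarrow>
      sl_lambda f q w N (cis_mat \<gamma> K) (- mat 1) n \<le> sl_lambda f q w N (cis_mat \<gamma> L) (- mat 1) n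
      \<and> sl_lambda f q w N (cis_mat \<gamma> L) (- mat 1) n \<le> sl_lambda f q w N (cis_mat \<gamma> K) (- mat 1) (n + 1)"
proof -
  have dims: "seq.dim (form_domain K) = N" "seq.dim (form_domain L) = N - 1"
    using dim_form_domain_singular[OF L(2)] by (simp_all add: form_domain_regular dim_supported)
  have sub: "form_domain L \<subseteq> form_domain K"
    unfolding form_domain_regular by (auto simp: form_domain_def)
  obtain e \<mu> where e: "pencil.eigenbasis (form_domain K) e \<mu>"
    using pencil.eigenbasis_exists[OF subspace_form_domain] form_domain_regular by blast
  obtain d \<nu> where d: "pencil.eigenbasis (form_domain L) d \<nu>"
    using pencil.eigenbasis_exists[OF subspace_form_domain] sub form_domain_regular by blast
  note spectrum_K = sl_spectrum_eq_eigenbasis[OF boundary_form_of_regular det_K e, unfolded dims]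
  note spectrum_L = sl_spectrum_eq_eigenbasis[OF boundary_form_of_singular[OF L] L(1) d, unfolded dims]
  show "sl_has_exactly f q w N (cis_mat \<gamma> L) (- mat 1) (N - 1)" by (rule spectrum_L)
  assume n: "n \<le> N - 2"
  have "seq.dim (form_domain K) = seq.dim (form_domain L) + 1" "n < seq.dim (form_domain L)"
    using N n by (simp_all add: dims)
  then have "\<mu> n \<le> \<nu> n" "\<nu> n \<le> \<mu> (n + 1)"
    using pencil.Cauchy_interlacing[OF subspace_form_domain sub _ _ e d] form_domain_regular by blast+
  then show "sl_lambda f q w N (cis_mat \<gamma> K) (- mat 1) n \<le> sl_lambda f q w N (cis_mat \<gamma> L) (- mat 1) n
      \<and> sl_lambda f q w N (cis_mat \<gamma> L) (- mat 1) n \<le> sl_lambda f q w N (cis_mat \<gamma> K) (- mat 1) (n + 1)"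
    using n N by (simp add: spectrum_K(2) spectrum_L(2))
qed

end

lemma K_hat_singular:
  assumes "det K = 1" "f0 \<noteq> 0" "K$1$1 \<noteq> 0"
  shows "det (K_hat f0 K) = 1" "f0 * K_hat f0 K $ 1 $ 2 = K_hat f0 K $ 1 $ 1"
    "det (K - K_hat f0 K) = 0"
  using assms by (simp_all add: K_hat_def mat22_def det_2 field_simps)

lemma K_tilde_singular:
  assumes "det K = 1" "f0 \<noteq> 0" "K$1$2 \<noteq> 0"
  shows "det (K_tilde f0 K) = 1" "f0 * K_tilde f0 K $ 1 $ 2 = K_tilde f0 K $ 1 $ 1"
    "det (K - K_tilde f0 K) = 0"
  using assms by (simp_all add: K_tilde_def mat22_def det_2 field_simps)

theorem theorem3p12:
  fixes f q w :: "nat \<Rightarrow> real" and N :: nat and \<gamma> :: real and K :: "real^2^2"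
  assumes "N \<ge> 2"
    and "\<forall>n\<le>N. f n \<noteq> 0"
    and "\<forall>n\<in>{1..N}. w n > 0"
    and "-pi < \<gamma>" and "\<gamma> \<le> pi"
    and "det K = 1"
    and "K$1$1 - f 0 * K$1$2 \<noteq> 0"
  shows "sl_has_exactly f q w N (cis_mat \<gamma> K) (- mat 1) N
    \<and> (K$1$1 \<noteq> 0 \<longrightarrow>
          sl_has_exactly f q w N (cis_mat \<gamma> (K_hat (f 0) K)) (- mat 1) (N - 1)
        \<and> (\<forall>n\<le>N-2.
             sl_lambda f q w N (cis_mat \<gamma> K) (- mat 1) n
               \<le> sl_lambda f q w N (cis_mat \<gamma> (K_hat (f 0) K)) (- mat 1) n
           \<and> sl_lambda f q w N (cis_mat \<gamma> (K_hat (f 0) K)) (- mat 1) n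
               \<le> sl_lambda f q w N (cis_mat \<gamma> K) (- mat 1) (n+1)))
    \<and> (K$1$2 \<noteq> 0 \<longrightarrow>
          sl_has_exactly f q w N (cis_mat \<gamma> (K_tilde (f 0) K)) (- mat 1) (N - 1)
        \<and> (\<forall>n\<le>N-2.
             sl_lambda f q w N (cis_mat \<gamma> K) (- mat 1) n
               \<le> sl_lambda f q w N (cis_mat \<gamma> (K_tilde (f 0) K)) (- mat 1) n
           \<and> sl_lambda f q w N (cis_mat \<gamma> (K_tilde (f 0) K)) (- mat 1) n
               \<le> sl_lambda f q w N (cis_mat \<gamma> K) (- mat 1) (n+1)))"
proof -
  interpret regular_sturm_liouville f q w N \<gamma> K
    by unfold_locales (use assms in auto)
  show ?thesis
    using regular_sl_has_exactly singular_sl_interlacing[OF K_hat_singular[OF det_K f0]]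
      singular_sl_interlacing[OF K_tilde_singular[OF det_K f0]] by blast
qed

end
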